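(* Let $\mathcal{M}$ be an irreducible weight module over the twisted Schrödinger-Virasoro Lie algebra $\mathscr{L}$. Assume that there exists $\lambda\in\mathbb{C}$ such that $\dim\mathcal{M}_\lambda=\infty$. Then $\mathrm{Supp}(\mathcal{M})=\lambda+\mathbb{Z}$ and, for every $k\in\mathbb{Z}$, $\dim\mathcal{M}_{\lambda+k}=\infty$.
   Context: The twisted Schrödinger-Virasoro Lie algebra $\mathscr{L}$ is the infinite-dimensional complex Lie algebra with $\mathbb{C}$-basis $\{L_n,Y_m,M_p\mid m,n,p\in\mathbb{Z}\}$ and relations, for all $m,m',n,p\in\mathbb{Z}$: $[L_n,L_p]=(p-n)L_{n+p}$, $[L_n,Y_m]=(m-\frac{n}{2})Y_{n+m}$, $[L_n,M_p]=pM_{n+p}$, $[Y_m,Y_{m'}]=(m'-m)M_{m+m'}$, $[Y_m,M_p]=[M_n,M_p]=0$. A weight module over $\mathscr{L}$ is a module on which the Cartan subalgebra $\mathfrak{H}=\mathrm{Span}_{\mathbb{C}}\{L_0,M_0\}$ acts diagonalizably. If $\mathcal{M}$ is an irreducible weight $\mathscr{L}$-module, then $M_0$ acts as a scalar and $\mathcal{M}=\bigoplus_{\lambda\in\mathbb{C}}\mathcal{M}_\lambda$, where $\mathcal{M}_\lambda=\{v\in\mathcal{M}\mid L_0v=\lambda v\}$ is the weight space of weight $\lambda$. The support of $\mathcal{M}$ is $\mathrm{Supp}(\mathcal{M})=\{\lambda\in\mathbb{C}\mid\mathcal{M}_\lambda\neq0\}$. *)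

theory Defs
  imports Complex_Main "HOL-Library.Poly_Mapping"
begin

section \<open>Lie algebras and their modules\<close>

locale lie_algebra = vector_space scale
  for scale :: "'k::field \<Rightarrow> 'g::ab_group_add \<Rightarrow> 'g" +
  fixes bracket :: "'g \<Rightarrow> 'g \<Rightarrow> 'g"
  assumes bracket_linear_left: "Vector_Spaces.linear scale scale (\<lambda>x. bracket x y)"
    and bracket_linear_right: "Vector_Spaces.linear scale scale (bracket x)"
    and bracket_self: "bracket x x = 0"
    and jacobi: "bracket x (bracket y z) + bracket y (bracket z x) + bracket z (bracket x y) = 0"

locale lie_module =
  lie_algebra scaleG bracket + V: vector_space scaleV
  for scaleG :: "'k::field \<Rightarrow> 'g::ab_group_add \<Rightarrow> 'g"
    and bracket :: "'g \<Rightarrow> 'g \<Rightarrow> 'g"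
    and scaleV :: "'k \<Rightarrow> 'v::ab_group_add \<Rightarrow> 'v" +
  fixes act :: "'g \<Rightarrow> 'v \<Rightarrow> 'v"
  assumes act_linear_left: "Vector_Spaces.linear scaleG scaleV (\<lambda>x. act x v)"
    and act_linear_right: "Vector_Spaces.linear scaleV scaleV (act x)"
    and act_bracket: "act (bracket x y) v = act x (act y v) - act y (act x v)"
begin

definition submodule :: "'v set \<Rightarrow> bool" where
  "submodule W \<longleftrightarrow> V.subspace W \<and> (\<forall>x. \<forall>w\<in>W. act x w \<in> W)"

definition irreducible_module :: bool where
  "irreducible_module \<longleftrightarrow>
     (UNIV :: 'v set) \<noteq> {0} \<and> (\<forall>W. submodule W \<longrightarrow> W = {0} \<or> W = UNIV)"

definition acts_diagonalizably :: "'g set \<Rightarrow> bool" where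
  "acts_diagonalizably H \<longleftrightarrow>
     (\<exists>B. V.independent B \<and> V.span B = UNIV \<and> (\<forall>h\<in>H. \<forall>b\<in>B. \<exists>c. act h b = scaleV c b))"

end

text \<open>The library's \<open>dim\<close> is a natural number, equal to 0 on infinite-dimensional subspaces.\<close>

definition (in vector_space) infinite_dimensional :: "'b set \<Rightarrow> bool" where
  "infinite_dimensional W \<longleftrightarrow> (\<nexists>B. finite B \<and> W \<subseteq> span B)"


section \<open>The twisted Schroedinger-Virasoro algebra\<close>

datatype sv_index = IL int | IY int | IM int

text \<open>The algebra is the space of finitely supported complex functions on the index set.\<close>

type_synonym sv = "sv_index \<Rightarrow>\<^sub>0 complex"

definition sv_scale :: "complex \<Rightarrow> sv \<Rightarrow> sv" where
  "sv_scale c x = Poly_Mapping.map ((*) c) x"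

definition sv_L :: "int \<Rightarrow> sv" where "sv_L n = Poly_Mapping.single (IL n) 1"
definition sv_Y :: "int \<Rightarrow> sv" where "sv_Y n = Poly_Mapping.single (IY n) 1"
definition sv_M :: "int \<Rightarrow> sv" where "sv_M n = Poly_Mapping.single (IM n) 1"

fun sv_basis_bracket :: "sv_index \<Rightarrow> sv_index \<Rightarrow> sv" where
  "sv_basis_bracket (IL n) (IL p) = sv_scale (of_int p - of_int n) (sv_L (n + p))"
| "sv_basis_bracket (IL n) (IY m) = sv_scale (of_int m - of_int n / 2) (sv_Y (n + m))"
| "sv_basis_bracket (IL n) (IM p) = sv_scale (of_int p) (sv_M (n + p))"
| "sv_basis_bracket (IY m) (IL n) = sv_scale (of_int n / 2 - of_int m) (sv_Y (n + m))"
| "sv_basis_bracket (IM p) (IL n) = sv_scale (- of_int p) (sv_M (n + p))"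
| "sv_basis_bracket (IY m) (IY m') = sv_scale (of_int m' - of_int m) (sv_M (m + m'))"
| "sv_basis_bracket (IY m) (IM p) = 0"
| "sv_basis_bracket (IM p) (IY m) = 0"
| "sv_basis_bracket (IM n) (IM p) = 0"

definition sv_bracket :: "sv \<Rightarrow> sv \<Rightarrow> sv" where
  "sv_bracket x y = (\<Sum>i\<in>Poly_Mapping.keys x. \<Sum>j\<in>Poly_Mapping.keys y.
     sv_scale (Poly_Mapping.lookup x i * Poly_Mapping.lookup y j) (sv_basis_bracket i j))"

lemma lookup_sv_scale [simp]: "Poly_Mapping.lookup (sv_scale c x) i = c * Poly_Mapping.lookup x i"
  by (simp add: sv_scale_def Poly_Mapping.map.rep_eq when_def)

global_interpretation sv: vector_space sv_scale
  by unfold_locales (auto intro!: poly_mapping_eqI simp: lookup_add algebra_simps)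

lemma sv_bracket_superset:
  assumes "finite A" "Poly_Mapping.keys x \<subseteq> A" "finite B" "Poly_Mapping.keys y \<subseteq> B"
  shows "sv_bracket x y = (\<Sum>i\<in>A. \<Sum>j\<in>B.
     sv_scale (Poly_Mapping.lookup x i * Poly_Mapping.lookup y j) (sv_basis_bracket i j))"
proof -
  have "sv_bracket x y = (\<Sum>i\<in>Poly_Mapping.keys x. \<Sum>j\<in>B.
     sv_scale (Poly_Mapping.lookup x i * Poly_Mapping.lookup y j) (sv_basis_bracket i j))"
    unfolding sv_bracket_def
    by (intro sum.cong refl sum.mono_neutral_left) (use assms in \<open>auto simp: in_keys_iff\<close>)
  also have "\<dots> = (\<Sum>i\<in>A. \<Sum>j\<in>B.
     sv_scale (Poly_Mapping.lookup x i * Poly_Mapping.lookup y j) (sv_basis_bracket i j))"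
    by (intro sum.mono_neutral_left) (use assms in \<open>auto simp: in_keys_iff\<close>)
  finally show ?thesis .
qed

lemma keys_sv_scale: "Poly_Mapping.keys (sv_scale c x) \<subseteq> Poly_Mapping.keys x"
  by (auto simp: in_keys_iff)

lemma sv_bracket_add_left: "sv_bracket (x + x') y = sv_bracket x y + sv_bracket x' y"
proof -
  let ?A = "Poly_Mapping.keys x \<union> Poly_Mapping.keys x'"
  have "Poly_Mapping.keys (x + x') \<subseteq> ?A" by (rule Poly_Mapping.keys_add)
  then show ?thesis
    by (simp add: sv_bracket_superset[of ?A _ "Poly_Mapping.keys y" y] lookup_add distrib_right
        sv.scale_left_distrib sum.distrib)
qed

lemma sv_bracket_add_right: "sv_bracket x (y + y') = sv_bracket x y + sv_bracket x y'"
proof -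
  let ?A = "Poly_Mapping.keys y \<union> Poly_Mapping.keys y'"
  have "Poly_Mapping.keys (y + y') \<subseteq> ?A" by (rule Poly_Mapping.keys_add)
  then show ?thesis
    by (simp add: sv_bracket_superset[of "Poly_Mapping.keys x" x ?A] lookup_add distrib_left
        sv.scale_left_distrib sum.distrib)
qed

lemma sv_bracket_scale_left: "sv_bracket (sv_scale c x) y = sv_scale c (sv_bracket x y)"
  by (simp add: sv_bracket_superset[of "Poly_Mapping.keys x" _ "Poly_Mapping.keys y" y] keys_sv_scale
      sv.scale_sum_right mult.assoc)

lemma sv_bracket_scale_right: "sv_bracket x (sv_scale c y) = sv_scale c (sv_bracket x y)"
  by (simp add: sv_bracket_superset[of "Poly_Mapping.keys x" x "Poly_Mapping.keys y"] keys_sv_scale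
      sv.scale_sum_right mult_ac)

lemma sv_linear_left: "Vector_Spaces.linear sv_scale sv_scale (\<lambda>x. sv_bracket x y)"
  by unfold_locales (simp_all add: sv_bracket_add_left sv_bracket_scale_left)

lemma sv_linear_right: "Vector_Spaces.linear sv_scale sv_scale (sv_bracket x)"
  by unfold_locales (simp_all add: sv_bracket_add_right sv_bracket_scale_right)

lemma sv_bracket_zero [simp]: "sv_bracket 0 y = 0" "sv_bracket x 0 = 0"
  by (simp_all add: sv_bracket_def)

lemma sv_bracket_single:
  "sv_bracket (Poly_Mapping.single i 1) (Poly_Mapping.single j 1) = sv_basis_bracket i j"
  by (simp add: sv_bracket_def)

lemma sv_relations:
  "sv_bracket (sv_L n) (sv_L p) = sv_scale (of_int p - of_int n) (sv_L (n + p))"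
  "sv_bracket (sv_L n) (sv_Y m) = sv_scale (of_int m - of_int n / 2) (sv_Y (n + m))"
  "sv_bracket (sv_L n) (sv_M p) = sv_scale (of_int p) (sv_M (n + p))"
  "sv_bracket (sv_Y m) (sv_Y m') = sv_scale (of_int m' - of_int m) (sv_M (m + m'))"
  "sv_bracket (sv_Y m) (sv_M p) = 0"
  "sv_bracket (sv_M n) (sv_M p) = 0"
  by (simp_all add: sv_L_def sv_Y_def sv_M_def sv_bracket_single)

lemma sv_relations':
  "sv_bracket (sv_Y m) (sv_L n) = sv_scale (of_int n / 2 - of_int m) (sv_Y (n + m))"
  "sv_bracket (sv_M p) (sv_L n) = sv_scale (- of_int p) (sv_M (n + p))"
  "sv_bracket (sv_M p) (sv_Y m) = 0"
  by (simp_all add: sv_L_def sv_Y_def sv_M_def sv_bracket_single)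

lemma sv_induct [case_names zero add scale L Y M]:
  assumes "P 0" "\<And>x y. P x \<Longrightarrow> P y \<Longrightarrow> P (x + y)" "\<And>c x. P x \<Longrightarrow> P (sv_scale c x)"
    and "\<And>n. P (sv_L n)" "\<And>n. P (sv_Y n)" "\<And>n. P (sv_M n)"
  shows "P x"
proof -
  have P1: "P (Poly_Mapping.single i 1)" for i
    using assms(4-6) by (cases i) (auto simp: sv_L_def sv_Y_def sv_M_def)
  have single: "Poly_Mapping.single i c = sv_scale c (Poly_Mapping.single i 1)" for i c
    by (rule poly_mapping_eqI) (simp add: lookup_single when_def)
  have PS: "P (Poly_Mapping.single i c)" for i c
    by (subst single) (intro assms(3) P1)
  show ?thesis
  proof (induction x rule: update_induct)
    case (update f a b)
    have "Poly_Mapping.update a b f = f + Poly_Mapping.single a b"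
      using update by (intro poly_mapping_eqI)
        (auto simp: lookup_update lookup_add lookup_single when_def in_keys_iff)
    then show ?case using update assms(2) PS[of a b] by simp
  qed (rule assms(1))
qed

lemma sv_bracket_anticomm: "sv_bracket x y = - sv_bracket y x"
proof -
  have *: "sv_basis_bracket i j = - sv_basis_bracket j i" for i j
    by (cases i; cases j)
      (simp_all add: add.commute sv.scale_minus_left[symmetric] del: sv.scale_minus_left)
  have "sv_bracket x y = (\<Sum>j\<in>Poly_Mapping.keys y. \<Sum>i\<in>Poly_Mapping.keys x.
     - sv_scale (Poly_Mapping.lookup y j * Poly_Mapping.lookup x i) (sv_basis_bracket j i))"
    unfolding sv_bracket_def
    by (subst sum.swap, intro sum.cong refl, subst *) (simp add: mult.commute)
  also have "\<dots> = - sv_bracket y x"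
    by (simp add: sv_bracket_def sum_negf)
  finally show ?thesis .
qed

lemma sv_jacobi:
  "sv_bracket x (sv_bracket y z) + sv_bracket y (sv_bracket z x) + sv_bracket z (sv_bracket x y) = 0"
  (is "?J x y z = 0")
proof -
  note lin = sv_bracket_add_left sv_bracket_add_right sv_bracket_scale_left sv_bracket_scale_right
  have addx: "?J (x + x') y z = ?J x y z + ?J x' y z" for x x' y z
    by (simp add: lin algebra_simps)
  have scx: "?J (sv_scale c x) y z = sv_scale c (?J x y z)" for c x y z
    by (simp add: lin sv.scale_right_distrib)
  have ind: "?J x y z = 0"
    if "\<And>n. ?J (sv_L n) y z = 0" "\<And>n. ?J (sv_Y n) y z = 0" "\<And>n. ?J (sv_M n) y z = 0" for x y z
  proof (induction x rule: sv_induct)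
    case zero show ?case by simp
  next
    case (add x x') then show ?case unfolding addx by simp
  next
    case (scale c x) then show ?case unfolding scx by simp
  qed (rule that)+
  have minus: "sv_bracket x (- y) = - sv_bracket x y" for x y
    using sv_bracket_scale_right[of x "- 1" y] by simp
  define G where "G = range sv_L \<union> range sv_Y \<union> range sv_M"
  have ind': "?J x y z = 0" if "\<And>g. g \<in> G \<Longrightarrow> ?J g y z = 0" for x y z
    by (rule ind; rule that; simp add: G_def)
  have base: "?J a b c = 0" if "a \<in> G" "b \<in> G" "c \<in> G" for a b c
    using that unfolding G_def
    by (auto simp: sv_relations sv_relations' lin minus simp del: sv.scale_scale sv.scale_minus_left)
       (auto intro!: poly_mapping_eqI simp: lookup_add algebra_simps add_divide_distrib diff_divide_distrib)
  have 1: "?J x b c = 0" if "b \<in> G" "c \<in> G" for x b c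
    using ind'[of b c x] base that by blast
  have 2: "?J x y c = 0" if c: "c \<in> G" for x y c
  proof -
    have "?J y c x = 0"
    proof (rule ind')
      fix g assume "g \<in> G"
      then have "?J x g c = 0" using 1 c by blast
      then show "?J g c x = 0" by (simp add: add_ac)
    qed
    then show ?thesis by (simp add: add_ac)
  qed
  show ?thesis
  proof (rule ind')
    fix g assume "g \<in> G"
    from 2[OF this, of y z] show "?J g y z = 0" by (simp add: add_ac)
  qed
qed

global_interpretation sv: lie_algebra sv_scale sv_bracket
proof
  show "sv_bracket x x = 0" for x
  proof -
    have "sv_bracket x x + sv_bracket x x = 0"
      using sv_bracket_anticomm[of x x] by (metis add.right_inverse)
    then have "sv_scale 2 (sv_bracket x x) = 0"
      using sv.scale_left_distrib[of 1 1 "sv_bracket x x"] by simp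
    then show ?thesis by simp
  qed
qed (simp_all add: sv_bracket_add_left sv_bracket_add_right sv_bracket_scale_left
    sv_bracket_scale_right sv_jacobi)

definition sv_cartan :: "sv set" where
  "sv_cartan = sv.span {sv_L 0, sv_M 0}"


section \<open>Weight modules over the twisted Schroedinger-Virasoro algebra\<close>

locale sv_module = lie_module sv_scale sv_bracket scale act
  for scale :: "complex \<Rightarrow> 'v::ab_group_add \<Rightarrow> 'v" and act :: "sv \<Rightarrow> 'v \<Rightarrow> 'v"
begin

definition weight_module :: bool where
  "weight_module \<longleftrightarrow> acts_diagonalizably sv_cartan"

definition weight_space :: "complex \<Rightarrow> 'v set" where
  "weight_space \<mu> = {v. act (sv_L 0) v = scale \<mu> v}"

definition support :: "complex set" where
  "support = {\<mu>. weight_space \<mu> \<noteq> {0}}"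

end

end

theory Submission imports Defs begin

text \<open>
Suppose a finite-dimensional weight space \<open>E \<mu>\<close> is adjacent to an infinite-dimensional one.
Finitely many operators into \<open>E \<mu>\<close> have an infinite-dimensional common kernel, and an
infinite-dimensional weight space contains no highest or lowest weight vector; hence both neighbours
of \<open>E \<mu>\<close> are infinite-dimensional. Choose \<open>v \<noteq> 0\<close> of weight \<open>\<mu> - 1\<close> killed by
\<open>L\<^sub>1, Y\<^sub>1, M\<^sub>1\<close> such that \<open>u = L\<^sub>2 v\<close> is killed by \<open>L\<^sub>-\<^sub>1, Y\<^sub>-\<^sub>1, M\<^sub>-\<^sub>1\<close>. Then all \<open>Y\<^sub>n\<close> and
\<open>M\<^sub>n\<close> kill \<open>u\<close>, so by irreducibility they act as zero. The degree-five relation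
\<open>(L\<^sub>1\<^sup>3 - 6 L\<^sub>2 L\<^sub>1 + 6 L\<^sub>3) u = 0\<close>, hit repeatedly by \<open>L\<^sub>-\<^sub>1\<close>, forces \<open>\<mu> \<in> {0, 1}\<close>; the
reflection \<open>X\<^sub>n \<mapsto> - X\<^sub>-\<^sub>n\<close> then gives \<open>\<mu> = 0\<close>. Finally \<open>u\<close> and \<open>L\<^sub>-\<^sub>2 u\<close> generate a
submodule of intermediate series type whose weight space at \<open>\<mu> + 1\<close> is the line through \<open>u\<close>,
a contradiction.
\<close>

section \<open>Linear algebra of infinite-dimensional subspaces\<close>

context vector_space
begin

text \<open>Lift a basis of the finite-dimensional image to a finite subset of \<open>W\<close>.
  Every vector of \<open>W\<close> differs from the span of this lift by a kernel vector, so a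
  finite spanning set of the kernel would yield one for \<open>W\<close>.\<close>

lemma infinite_dimensional_kernel:
  assumes "subspace W" "infinite_dimensional W" "Vector_Spaces.linear scale scale f"
    and "f ` W \<subseteq> F" "\<not> infinite_dimensional F"
  shows "infinite_dimensional {w \<in> W. f w = 0}"
  unfolding infinite_dimensional_def
proof
  interpret f: Vector_Spaces.linear scale scale f by fact
  assume "\<exists>B. finite B \<and> {w \<in> W. f w = 0} \<subseteq> span B"
  then obtain B where B: "finite B" "{w \<in> W. f w = 0} \<subseteq> span B" by blast
  obtain D where D: "finite D" "F \<subseteq> span D"
    using assms(5) by (auto simp: infinite_dimensional_def)
  obtain C where C: "C \<subseteq> f ` W" "independent C" "f ` W \<subseteq> span C"
    using maximal_independent_subset[of "f ` W"] by blast
  have "C \<subseteq> span D" using C(1) assms(4) D(2) by blast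
  then have "finite C" using independent_span_bound[OF D(1) C(2)] by blast
  obtain A where A: "A \<subseteq> W" "finite A" "C = f ` A"
    using finite_subset_image[OF \<open>finite C\<close> C(1)] by blast
  have "w \<in> span (A \<union> B)" if w: "w \<in> W" for w
  proof -
    have "f w \<in> span (f ` A)" using C(3) A(3) w by blast
    then obtain a where a: "a \<in> span A" "f w = f a" by (auto simp: f.span_image)
    have "a \<in> W" using a(1) A(1) assms(1) span_minimal by blast
    then have "w - a \<in> W" "f (w - a) = 0"
      using w a(2) subspace_diff[OF assms(1)] by (auto simp: f.diff)
    then have "w - a \<in> span (A \<union> B)" using B(2) span_mono[of B "A \<union> B"] by blast
    moreover have "a \<in> span (A \<union> B)" using a(1) span_mono[of A "A \<union> B"] by blast
    ultimately have "(w - a) + a \<in> span (A \<union> B)" by (rule span_add)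
    then show ?thesis by simp
  qed
  then have "finite (A \<union> B) \<and> W \<subseteq> span (A \<union> B)" using A(2) B(1) by blast
  then show False using assms(2) unfolding infinite_dimensional_def by blast
qed

lemma infinite_dimensional_nonzero:
  assumes "infinite_dimensional W"
  obtains w where "w \<in> W" "w \<noteq> 0"
proof -
  have "\<not> W \<subseteq> span {}" using assms unfolding infinite_dimensional_def by blast
  then show ?thesis using that by auto
qed

lemma finite_subset_span:
  assumes "x \<in> span S"
  obtains T where "finite T" "T \<subseteq> S" "x \<in> span T"
proof -
  obtain t r where "finite t" "t \<subseteq> S" "x = (\<Sum>a\<in>t. scale (r a) a)"
    using assms by (auto simp: span_explicit)
  then have "x \<in> span t" by (simp add: span_sum span_scale span_base)
  then show ?thesis using that \<open>finite t\<close> \<open>t \<subseteq> S\<close> by blast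
qed

end

section \<open>Grading, reflection and the operator form of the representation\<close>

fun deg :: "sv_index \<Rightarrow> int" where
  "deg (IL n) = n" | "deg (IY n) = n" | "deg (IM n) = n"

fun reflect :: "sv_index \<Rightarrow> sv_index" where
  "reflect (IL n) = IL (- n)" | "reflect (IY n) = IY (- n)" | "reflect (IM n) = IM (- n)"

lemma deg_reflect [simp]: "deg (reflect i) = - deg i" by (cases i) auto

lemma reflect_reflect [simp]: "reflect (reflect i) = i" by (cases i) auto

text \<open>Only the operators of the basis elements are kept. Reflection then gives a second
  interpretation of the same locale on the same space, so statements about raising operators can be
  mirrored instead of proved twice.\<close>

locale irreducible_sv_rep = vector_space scale
  for scale :: "complex \<Rightarrow> 'v::ab_group_add \<Rightarrow> 'v" +
  fixes X :: "sv_index \<Rightarrow> 'v \<Rightarrow> 'v"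
  assumes lin: "Vector_Spaces.linear scale scale (X i)"
    and LL: "X (IL n) (X (IL p) v) = X (IL p) (X (IL n) v) + scale (of_int p - of_int n) (X (IL (n + p)) v)"
    and LY: "X (IL n) (X (IY m) v) = X (IY m) (X (IL n) v) + scale (of_int m - of_int n / 2) (X (IY (n + m)) v)"
    and LM: "X (IL n) (X (IM p) v) = X (IM p) (X (IL n) v) + scale (of_int p) (X (IM (n + p)) v)"
    and YY: "X (IY m) (X (IY m') v) = X (IY m') (X (IY m) v) + scale (of_int m' - of_int m) (X (IM (m + m')) v)"
    and YM: "X (IY m) (X (IM p) v) = X (IM p) (X (IY m) v)"
    and MM: "X (IM n) (X (IM p) v) = X (IM p) (X (IM n) v)"
    and irred: "subspace W \<Longrightarrow> (\<And>i w. w \<in> W \<Longrightarrow> X i w \<in> W) \<Longrightarrow> W = {0} \<or> W = UNIV"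
    and M0: "\<exists>c. \<forall>v. X (IM 0) v = scale c v"
begin

abbreviation "L n \<equiv> X (IL n)"
abbreviation "Y n \<equiv> X (IY n)"
abbreviation "M n \<equiv> X (IM n)"

definition E :: "complex \<Rightarrow> 'v set" where "E \<nu> = {v. L 0 v = scale \<nu> v}"

lemma X_add: "X i (v + w) = X i v + X i w"
  and X_diff: "X i (v - w) = X i v - X i w"
  and X_minus: "X i (- v) = - X i v"
  and X_scale: "X i (scale c v) = scale c (X i v)"
  and X_zero [simp]: "X i 0 = 0"
proof -
  interpret f: Vector_Spaces.linear scale scale "X i" by (rule lin)
  show "X i (v + w) = X i v + X i w" "X i (v - w) = X i v - X i w" "X i (- v) = - X i v"
    "X i (scale c v) = scale c (X i v)" "X i 0 = 0"
    by (simp_all add: f.add f.diff f.neg f.scale)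
qed

lemmas X_simps = X_add X_diff X_minus X_scale

text \<open>Later arguments only need the degree of a bracket. Where the bracket vanishes, any index
  of the right degree serves, with \<open>c = 0\<close>.\<close>

lemma commutator:
  obtains k c where "deg k = deg i + deg j"
    "\<And>v. X i (X j v) = X j (X i v) + scale c (X k v)"
proof -
  have "\<exists>k c. deg k = deg i + deg j \<and> (\<forall>v. X i (X j v) = X j (X i v) + scale c (X k v))"
  proof (cases i; cases j)
    fix n p assume [simp]: "i = IL n" "j = IL p"
    show ?thesis using LL[of n p] by (intro exI[of _ "IL (n + p)"]) auto
  next
    fix n p assume [simp]: "i = IL n" "j = IY p"
    show ?thesis using LY[of n p] by (intro exI[of _ "IY (n + p)"]) auto
  next
    fix n p assume [simp]: "i = IL n" "j = IM p"
    show ?thesis using LM[of n p] by (intro exI[of _ "IM (n + p)"]) auto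
  next
    fix n p assume [simp]: "i = IY p" "j = IL n"
    show ?thesis using LY[of n p]
      by (intro exI[of _ "IY (n + p)"] exI[of _ "- (of_int p - of_int n / 2)"])
        (auto simp: scale_left_diff_distrib)
  next
    fix n p assume [simp]: "i = IM p" "j = IL n"
    show ?thesis using LM[of n p]
      by (intro exI[of _ "IM (n + p)"] exI[of _ "- of_int p"]) auto
  next
    fix n p assume [simp]: "i = IY n" "j = IY p"
    show ?thesis using YY[of n p] by (intro exI[of _ "IM (n + p)"]) auto
  next
    fix n p assume [simp]: "i = IY n" "j = IM p"
    show ?thesis using YM[of n p] by (intro exI[of _ "IM (n + p)"] exI[of _ 0]) auto
  next
    fix n p assume [simp]: "i = IM n" "j = IY p"
    show ?thesis using YM[of p n] by (intro exI[of _ "IM (n + p)"] exI[of _ 0]) auto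
  next
    fix n p assume [simp]: "i = IM n" "j = IM p"
    show ?thesis using MM[of n p] by (intro exI[of _ "IM (n + p)"] exI[of _ 0]) auto
  qed
  then show ?thesis using that by blast
qed

text \<open>The structure constants are homogeneous of degree one in the indices, so negating all
  indices changes the sign of each bracket; the sign in front of \<open>X\<close> compensates for
  this.\<close>

lemma reflected: "irreducible_sv_rep scale (\<lambda>i v. - X (reflect i) v)"
proof
  fix i c and v w :: 'v and n p m m' :: int
  show "- X (reflect i) (v + w) = - X (reflect i) v + - X (reflect i) w"
    "- X (reflect i) (scale c v) = scale c (- X (reflect i) v)"
    by (simp_all add: X_simps)
  show "- X (reflect (IL n)) (- X (reflect (IL p)) v) = - X (reflect (IL p)) (- X (reflect (IL n)) v)
     + scale (of_int p - of_int n) (- X (reflect (IL (n + p))) v)"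
    using LL[of "-n" "-p" v] by (simp add: X_simps algebra_simps)
  show "- X (reflect (IL n)) (- X (reflect (IY m)) v) = - X (reflect (IY m)) (- X (reflect (IL n)) v)
     + scale (of_int m - of_int n / 2) (- X (reflect (IY (n + m))) v)"
    using LY[of "-n" "-m" v] by (simp add: X_simps algebra_simps)
  show "- X (reflect (IL n)) (- X (reflect (IM p)) v) = - X (reflect (IM p)) (- X (reflect (IL n)) v)
     + scale (of_int p) (- X (reflect (IM (n + p))) v)"
    using LM[of "-n" "-p" v] by (simp add: X_simps algebra_simps)
  show "- X (reflect (IY m)) (- X (reflect (IY m')) v) = - X (reflect (IY m')) (- X (reflect (IY m)) v)
     + scale (of_int m' - of_int m) (- X (reflect (IM (m + m'))) v)"
    using YY[of "-m" "-m'" v] by (simp add: X_simps algebra_simps)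
  show "- X (reflect (IY m)) (- X (reflect (IM p)) v) = - X (reflect (IM p)) (- X (reflect (IY m)) v)"
    using YM[of "-m" "-p" v] by (simp add: X_simps)
  show "- X (reflect (IM n)) (- X (reflect (IM p)) v) = - X (reflect (IM p)) (- X (reflect (IM n)) v)"
    using MM[of "-n" "-p" v] by (simp add: X_simps)
next
  fix W assume W: "subspace W" "\<And>i w. w \<in> W \<Longrightarrow> - X (reflect i) w \<in> W"
  show "W = {0} \<or> W = UNIV"
  proof (rule irred[OF W(1)])
    fix i w assume "w \<in> W"
    then have "- (- X (reflect (reflect i)) w) \<in> W" using W subspace_neg by blast
    then show "X i w \<in> W" by simp
  qed
next
  obtain c where "\<forall>v. M 0 v = scale c v" using M0 by blast
  then show "\<exists>c. \<forall>v. - X (reflect (IM 0)) v = scale c v"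
    by (intro exI[of _ "- c"]) simp
qed

lemma E_reflected: "irreducible_sv_rep.E scale (\<lambda>i v. - X (reflect i) v) \<nu> = E (- \<nu>)"
proof -
  have "(- X (reflect (IL 0)) v = scale \<nu> v) = (L 0 v = scale (- \<nu>) v)" for v
    using scale_minus_left[of \<nu> v] by (metis minus_minus minus_zero reflect.simps(1))
  then show ?thesis unfolding E_def irreducible_sv_rep.E_def[OF reflected] by (rule Collect_cong)
qed

section \<open>Weight spaces and their independence\<close>

lemma E_subspace: "subspace (E \<nu>)"
  unfolding E_def by (rule subspaceI) (auto simp: X_simps scale_right_distrib scale_left_commute)

lemma L0_commutator: "L 0 (X i v) = X i (L 0 v) + scale (of_int (deg i)) (X i v)"
  using LL[of 0 "deg i" v] LY[of 0 "deg i" v] LM[of 0 "deg i" v] by (cases i) simp_all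

lemma X_E: "v \<in> E \<nu> \<Longrightarrow> X i v \<in> E (\<nu> + of_int (deg i))"
  unfolding E_def by (simp add: L0_commutator X_simps scale_left_distrib)

lemma X_E':
  assumes "v \<in> E \<nu>" "\<nu>' = \<nu> + of_int (deg i)"
  shows "X i v \<in> E \<nu>'"
  using X_E assms by blast

text \<open>Applying \<open>L 0\<close> minus the scalar \<open>a\<close> removes the summand at
  \<open>a\<close> and multiplies the others by the nonzero factors \<open>\<kappa> - a\<close>,
  which leaves a shorter vanishing sum.\<close>

lemma eigenvectors_sum_zero:
  assumes "finite K" "\<And>\<kappa>. \<kappa> \<in> K \<Longrightarrow> f \<kappa> \<in> E \<kappa>" "(\<Sum>\<kappa>\<in>K. f \<kappa>) = 0"
  shows "\<forall>\<kappa>\<in>K. f \<kappa> = 0"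
  using assms
proof (induction K arbitrary: f rule: finite_induct)
  case (insert a K)
  interpret f: Vector_Spaces.linear scale scale "L 0" by (rule lin)
  have s: "f a + sum f K = 0" using insert by simp
  have "(\<Sum>\<kappa>\<in>K. scale (\<kappa> - a) (f \<kappa>)) = L 0 (sum f K) - scale a (sum f K)"
    using insert.prems(1)
    by (auto simp: f.sum E_def scale_left_diff_distrib sum_subtractf scale_sum_right)
  also have "sum f K = - f a" using s by (simp add: add_eq_0_iff)
  also have "L 0 (- f a) - scale a (- f a) = 0"
    using insert.prems(1)[of a] by (simp add: X_simps E_def)
  finally have "\<forall>\<kappa>\<in>K. scale (\<kappa> - a) (f \<kappa>) = 0"
    using insert.prems(1) subspace_scale[OF E_subspace] by (intro insert.IH) auto
  then have *: "\<forall>\<kappa>\<in>K. f \<kappa> = 0" using insert.hyps(2) by auto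
  then show ?case using s by simp
qed simp

lemma span_E_sum:
  assumes "x \<in> span (\<Union>\<kappa>\<in>N. E \<kappa>)"
  shows "\<exists>K f. finite K \<and> K \<subseteq> N \<and> (\<forall>\<kappa>. f \<kappa> \<in> E \<kappa>) \<and> (\<forall>\<kappa>. \<kappa> \<notin> K \<longrightarrow> f \<kappa> = 0) \<and> x = (\<Sum>\<kappa>\<in>K. f \<kappa>)"
  using assms
proof (induction rule: span_induct_alt)
  case base
  show ?case by (rule exI[of _ "{}"], rule exI[of _ "\<lambda>_. 0"]) (simp add: subspace_0[OF E_subspace])
next
  case (step c y z)
  then obtain K f where K: "finite K" "K \<subseteq> N" "\<forall>\<kappa>. f \<kappa> \<in> E \<kappa>" "\<forall>\<kappa>. \<kappa> \<notin> K \<longrightarrow> f \<kappa> = 0" "z = (\<Sum>\<kappa>\<in>K. f \<kappa>)"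
    by blast
  obtain k where k: "k \<in> N" "y \<in> E k" using step by blast
  define g where "g \<kappa> = f \<kappa> + (if \<kappa> = k then scale c y else 0)" for \<kappa>
  \<comment> \<open>Since \<open>f\<close> vanishes off \<open>K\<close>, the cases of
    \<open>k\<close> inside and outside \<open>K\<close> need no separation.\<close>
  have "sum f (insert k K) = sum f K" using K by (intro sum.mono_neutral_right) auto
  then have "sum g (insert k K) = scale c y + z"
    using K(1,5) unfolding g_def by (simp only: sum.distrib) (simp add: add.commute)
  then show ?case using K k subspace_add[OF E_subspace] subspace_scale[OF E_subspace]
    by (intro exI[of _ "insert k K"] exI[of _ g]) (auto simp: g_def)
qed

text \<open>Placing \<open>- v\<close> at the free index \<nu> turns a decomposition of
  \<open>v\<close> into a vanishing sum of eigenvectors.\<close>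

lemma E_independent:
  assumes "v \<in> E \<nu>" "v \<in> span (\<Union>\<kappa>\<in>N. E \<kappa>)" "\<nu> \<notin> N"
  shows "v = 0"
proof -
  obtain K f where K: "finite K" "K \<subseteq> N" "\<forall>\<kappa>. f \<kappa> \<in> E \<kappa>" "\<forall>\<kappa>. \<kappa> \<notin> K \<longrightarrow> f \<kappa> = 0" "v = (\<Sum>\<kappa>\<in>K. f \<kappa>)"
    using span_E_sum[OF assms(2)] by blast
  have \<nu>: "\<nu> \<notin> K" using K(2) assms(3) by blast
  have "sum (f(\<nu> := - v)) (insert \<nu> K) = - v + sum (f(\<nu> := - v)) K" using K(1) \<nu> by simp
  also have "sum (f(\<nu> := - v)) K = sum f K" using \<nu> by (intro sum.cong) auto
  finally have "\<forall>\<kappa>\<in>insert \<nu> K. (f(\<nu> := - v)) \<kappa> = 0"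
    using K assms(1) subspace_neg[OF E_subspace] by (intro eigenvectors_sum_zero) auto
  then show ?thesis by simp
qed

text \<open>Every \<open>X i\<close> shifts weights by an integer, so this span is a nonzero
  submodule.\<close>

lemma span_E_lattice:
  assumes "w \<in> E \<nu>" "w \<noteq> 0"
  shows "span (\<Union>\<kappa>\<in>{\<nu> + of_int k | k. True}. E \<kappa>) = UNIV" (is "span ?U = _")
proof -
  have "span ?U = {0} \<or> span ?U = UNIV"
  proof (rule irred[OF subspace_span])
    fix i x assume "x \<in> span ?U"
    then show "X i x \<in> span ?U"
    proof (induction rule: span_induct_alt)
      case (step c y z)
      then obtain k :: int where "y \<in> E (\<nu> + of_int k)" by blast
      then have "X i y \<in> E (\<nu> + of_int (k + deg i))" by (auto intro: X_E')
      then have "X i y \<in> span ?U" by (intro span_base) blast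
      then show ?case using step by (auto simp: X_simps intro: span_add span_scale)
    qed (simp add: span_zero)
  qed
  moreover have "w \<in> ?U" using assms(1) by (auto intro: exI[of _ 0])
  ultimately show ?thesis using assms(2) span_base[of w ?U] by blast
qed

section \<open>Highest weight vectors\<close>

text \<open>This is the image of \<open>T\<close> under the enveloping algebra of the negative part,
  in a form that allows rule induction without constructing that algebra.\<close>

inductive_set lower_closure :: "'v set \<Rightarrow> 'v set" for T where
  base: "t \<in> T \<Longrightarrow> t \<in> lower_closure T"
| zero: "0 \<in> lower_closure T"
| add: "x \<in> lower_closure T \<Longrightarrow> y \<in> lower_closure T \<Longrightarrow> x + y \<in> lower_closure T"
| scale: "x \<in> lower_closure T \<Longrightarrow> scale c x \<in> lower_closure T"
| step: "x \<in> lower_closure T \<Longrightarrow> deg i < 0 \<Longrightarrow> X i x \<in> lower_closure T"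

text \<open>Operators of degree at least 0 can be moved past the negative ones, so the lower closure
  of \<open>T\<close> is a submodule and hence everything. Modulo strictly lower weights each vector
  then lies in \<open>T\<close>. Stability under \<open>Y 0\<close> is required because
  \<open>Y 0\<close> has degree 0 without acting by a scalar.\<close>

lemma highest_weight_generated:
  assumes T: "subspace T" "T \<subseteq> E \<nu>" "T \<noteq> {0}"
    and Y0: "\<And>t. t \<in> T \<Longrightarrow> Y 0 t \<in> T"
    and pos: "\<And>i t. t \<in> T \<Longrightarrow> deg i > 0 \<Longrightarrow> X i t = 0"
  shows "E \<nu> \<subseteq> T" and "n > 0 \<Longrightarrow> E (\<nu> + of_int n) = {0}"
proof -
  let ?S = "lower_closure T"
  have T0: "X i t \<in> T" if "t \<in> T" "deg i = 0" for i t
  proof (cases i)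
    case (IL k)
    then have "X i t = scale \<nu> t" using that T(2) by (auto simp: E_def)
    then show ?thesis using that subspace_scale[OF T(1)] by simp
  next
    case (IY k)
    then show ?thesis using that Y0 by simp
  next
    case (IM k)
    then show ?thesis using that M0 subspace_scale[OF T(1)] by auto
  qed
  \<comment> \<open>The claim is made for all \<open>i\<close> at once, since moving
    \<open>X i\<close> past \<open>X j\<close> creates an \<open>X k\<close> whose degree may again
    be nonnegative.\<close>
  have closed: "\<forall>i. deg i \<ge> 0 \<longrightarrow> X i x \<in> ?S" if "x \<in> ?S" for x
    using that
  proof (induction rule: lower_closure.induct)
    case (base t)
    then show ?case using pos T0 lower_closure.base lower_closure.zero
      by (metis order_le_less)
  next
    case (step x j)
    show ?case
    proof (intro allI impI)
      fix i assume i: "deg i \<ge> 0"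
      obtain k c where k: "deg k = deg i + deg j" "X i (X j x) = X j (X i x) + scale c (X k x)"
        using commutator by metis
      have "X k x \<in> ?S" using step by (cases "deg k \<ge> 0") (auto intro: lower_closure.step)
      moreover have "X j (X i x) \<in> ?S" using step i by (auto intro: lower_closure.step)
      ultimately show "X i (X j x) \<in> ?S"
        unfolding k(2) by (intro lower_closure.add lower_closure.scale)
    qed
  qed (auto simp: X_simps intro: lower_closure.intros)
  have "?S = {0} \<or> ?S = UNIV"
  proof (rule irred)
    show "subspace ?S" by (rule subspaceI) (auto intro: lower_closure.intros)
    show "X i w \<in> ?S" if "w \<in> ?S" for i w
      using that closed by (cases "deg i \<ge> 0") (auto intro: lower_closure.step)
  qed
  moreover have "T \<subseteq> ?S" by (auto intro: lower_closure.base)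
  ultimately have S: "?S = UNIV" using T(1,3) subspace_0 by blast
  define N where "N = {\<nu> + of_int n | n. n < 0}"
  have N1: "x \<in> span (\<Union>\<kappa>\<in>N. E \<kappa>)" if "x \<in> E (\<nu> + of_int n)" "n < 0" for x n
    using that unfolding N_def by (intro span_base) blast
  have X_N: "X i x \<in> span (\<Union>\<kappa>\<in>N. E \<kappa>)" if "deg i < 0" "x \<in> span (\<Union>\<kappa>\<in>N. E \<kappa>)" for i x
    using that(2)
  proof (induction rule: span_induct_alt)
    case (step c y z)
    then obtain n where n: "n < 0" "y \<in> E (\<nu> + of_int n)" unfolding N_def by blast
    have "X i y \<in> E (\<nu> + of_int (n + deg i))" by (rule X_E'[OF n(2)]) simp
    then have "X i y \<in> span (\<Union>\<kappa>\<in>N. E \<kappa>)" by (rule N1) (use n(1) that(1) in simp)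
    then show ?case using step by (auto simp: X_simps intro: span_add span_scale)
  qed (simp add: span_zero)
  have decomp: "\<exists>t\<in>T. x - t \<in> span (\<Union>\<kappa>\<in>N. E \<kappa>)" for x
  proof -
    have "x \<in> ?S" using S by blast
    then show ?thesis
    proof (induction rule: lower_closure.induct)
      case (base t)
      then show ?case by (auto intro!: bexI[of _ t] span_zero)
    next
      case zero
      then show ?case using subspace_0[OF T(1)] by (auto intro!: bexI[of _ 0] span_zero)
    next
      case (add x y)
      then obtain t t' where t: "t \<in> T" "t' \<in> T" "x - t \<in> span (\<Union>\<kappa>\<in>N. E \<kappa>)" "y - t' \<in> span (\<Union>\<kappa>\<in>N. E \<kappa>)"
        by blast
      have "(x + y) - (t + t') \<in> span (\<Union>\<kappa>\<in>N. E \<kappa>)"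
        using span_add[OF t(3,4)] by (simp add: algebra_simps)
      then show ?case using subspace_add[OF T(1) t(1,2)] by blast
    next
      case (scale x c)
      then obtain t where t: "t \<in> T" "x - t \<in> span (\<Union>\<kappa>\<in>N. E \<kappa>)" by blast
      have "scale c x - scale c t \<in> span (\<Union>\<kappa>\<in>N. E \<kappa>)"
        using span_scale[OF t(2), of c] by (simp add: scale_right_diff_distrib)
      then show ?case using subspace_scale[OF T(1) t(1)] by blast
    next
      case (step x i)
      then obtain t where t: "t \<in> T" "x - t \<in> span (\<Union>\<kappa>\<in>N. E \<kappa>)" by blast
      have "X i t \<in> E (\<nu> + of_int (deg i))" using t(1) T(2) by (auto intro: X_E)
      then have "X i t \<in> span (\<Union>\<kappa>\<in>N. E \<kappa>)" using step by (intro N1)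
      then have "X i (x - t) + X i t \<in> span (\<Union>\<kappa>\<in>N. E \<kappa>)"
        using X_N[OF _ t(2)] step by (intro span_add) auto
      \<comment> \<open>The degree of \<open>X i\<close> is negative, so even the part in
        \<open>T\<close> drops below \<nu> and the witness becomes 0.\<close>
      then show ?case using subspace_0[OF T(1)] by (intro bexI[of _ 0]) (simp_all add: X_simps)
    qed
  qed
  show "E \<nu> \<subseteq> T"
  proof
    fix x assume x: "x \<in> E \<nu>"
    obtain t where t: "t \<in> T" "x - t \<in> span (\<Union>\<kappa>\<in>N. E \<kappa>)" using decomp by blast
    have "x - t \<in> E \<nu>" using x t T(2) subspace_diff[OF E_subspace] by blast
    then have "x - t = 0" by (rule E_independent[OF _ t(2)]) (auto simp: N_def)
    then show "x \<in> T" using t(1) by simp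
  qed
  assume n: "n > 0"
  have "x = 0" if x: "x \<in> E (\<nu> + of_int n)" for x
  proof -
    let ?N = "insert \<nu> N"
    obtain t where t: "t \<in> T" "x - t \<in> span (\<Union>\<kappa>\<in>N. E \<kappa>)" using decomp by blast
    have "x - t \<in> span (\<Union>\<kappa>\<in>?N. E \<kappa>)" using t(2) span_mono[of "\<Union>\<kappa>\<in>N. E \<kappa>" "\<Union>\<kappa>\<in>?N. E \<kappa>"] by blast
    moreover have "t \<in> span (\<Union>\<kappa>\<in>?N. E \<kappa>)" using t(1) T(2) by (intro span_base) blast
    ultimately have "(x - t) + t \<in> span (\<Union>\<kappa>\<in>?N. E \<kappa>)" by (rule span_add)
    then have "x \<in> span (\<Union>\<kappa>\<in>?N. E \<kappa>)" by simp
    then show ?thesis by (rule E_independent[OF x]) (use n in \<open>auto simp: N_def\<close>)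
  qed
  then show "E (\<nu> + of_int n) = {0}" using subspace_0[OF E_subspace] by blast
qed

text \<open>The space \<open>T\<close> of all highest weight vectors of weight \<nu> is stable under
  \<open>Y 0\<close>, because bracketing with \<open>Y 0\<close> preserves positive degree.
  Finiteness needs a further argument, as \<open>Y 0\<close> need not be diagonalizable.\<close>

lemma highest_weight_vector:
  assumes w: "w \<in> E \<nu>" "w \<noteq> 0" and pos: "\<And>i. deg i > 0 \<Longrightarrow> X i w = 0"
  shows "\<not> infinite_dimensional (E \<nu>)" and "n > 0 \<Longrightarrow> E (\<nu> + of_int n) = {0}"
proof -
  define T where "T = {t \<in> E \<nu>. \<forall>i. deg i > 0 \<longrightarrow> X i t = 0}"
  have wT: "w \<in> T" using assms by (simp add: T_def)
  have Tsub: "subspace T"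
    by (rule subspaceI) (auto simp: T_def X_simps subspace_0[OF E_subspace] subspace_add[OF E_subspace] subspace_scale[OF E_subspace])
  have YT: "Y 0 t \<in> T" if t: "t \<in> T" for t
  proof -
    have "X i (Y 0 t) = 0" if i: "deg i > 0" for i
    proof -
      obtain k c where k: "deg k = deg i + deg (IY 0)" "X i (Y 0 t) = Y 0 (X i t) + scale c (X k t)"
        using commutator by metis
      have "X i t = 0" "X k t = 0" using t i k(1) by (auto simp: T_def)
      then show ?thesis using k(2) by simp
    qed
    moreover have "Y 0 t \<in> E \<nu>" using t by (auto simp: T_def intro: X_E')
    ultimately show ?thesis by (simp add: T_def)
  qed
  show "E (\<nu> + of_int n) = {0}" if "n > 0"
    by (rule highest_weight_generated(2)[OF Tsub _ _ YT _ that]) (use wT w in \<open>auto simp: T_def\<close>)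
  have generated: "E \<nu> \<subseteq> F" if "subspace F" "F \<subseteq> T" "F \<noteq> {0}" "\<And>t. t \<in> F \<Longrightarrow> Y 0 t \<in> F" for F
    using that by (intro highest_weight_generated(1)) (auto simp: T_def)
  txt \<open>Highest weight vectors of weight \<open>\<nu>\<close> form a simple \<open>\<complex>[Y\<^sub>0]\<close>-module; it is finite-dimensional
    since either \<open>Y\<^sub>0\<close> kills \<open>w\<close> or \<open>w\<close> lies in the submodule generated by \<open>Y\<^sub>0 w\<close>.\<close>
  define y where "y k = (Y 0 ^^ k) w" for k
  have y0: "y 0 = w" and ySuc: "Y 0 (y k) = y (Suc k)" for k by (simp_all add: y_def)
  have yT: "y k \<in> T" for k by (induction k) (use wT YT in \<open>auto simp: y_def\<close>)
  have span_T: "span (y ` A) \<subseteq> T" for A using yT Tsub by (intro span_minimal) auto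
  have Y_span: "Y 0 x \<in> span (y ` Suc ` A)" if "x \<in> span (y ` A)" for x A
    using that
  proof (induction rule: span_induct_alt)
    case (step c a b)
    then obtain k where "k \<in> A" "a = y k" by blast
    then have "Y 0 a \<in> span (y ` Suc ` A)" using ySuc by (auto intro: span_base)
    then show ?case using step by (auto simp: X_simps intro: span_add span_scale)
  qed (simp add: span_zero)
  have "\<exists>F. finite F \<and> E \<nu> \<subseteq> span F"
  proof (cases "y 1 = 0")
    case True
    have "E \<nu> \<subseteq> span (y ` {0})"
    proof (rule generated)
      show "span (y ` {0}) \<noteq> {0}" using w(2) y0 span_base[of w "y ` {0}"] by auto
      show "Y 0 t \<in> span (y ` {0})" if "t \<in> span (y ` {0})" for t
        using Y_span[OF that] True by (simp add: span_zero)
    qed (simp_all only: span_T subspace_span)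
    then show ?thesis by (intro exI[of _ "y ` {0}"] conjI) auto
  next
    case False
    have "E \<nu> \<subseteq> span (y ` Suc ` UNIV)"
    proof (rule generated)
      show "span (y ` Suc ` UNIV) \<noteq> {0}" using False span_base[of "y 1" "y ` Suc ` UNIV"] by auto
      show "Y 0 t \<in> span (y ` Suc ` UNIV)" if "t \<in> span (y ` Suc ` UNIV)" for t
        using Y_span[OF that] span_mono[of "y ` Suc ` Suc ` UNIV" "y ` Suc ` UNIV"] by blast
    qed (simp_all only: span_T subspace_span)
    then have "w \<in> span (y ` Suc ` UNIV)" using w(1) by blast
    then obtain D where D: "finite D" "D \<subseteq> y ` Suc ` UNIV" "w \<in> span D"
      by (rule finite_subset_span)
    obtain A where A: "finite A" "D = y ` Suc ` A"
      using finite_subset_image[of D "\<lambda>k. y (Suc k)" UNIV] D by (auto simp: image_image)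
    obtain m where "A \<subseteq> {..<m}" using A(1) by (auto simp: finite_nat_set_iff_bounded)
    then have "span D \<subseteq> span (y ` Suc ` {..<m})" unfolding A(2) by (intro span_mono image_mono)
    then have "\<exists>m. w \<in> span (y ` Suc ` {..<m})" using D(3) by blast
    \<comment> \<open>The indices run from 1 to \<open>m\<close>. Minimality of \<open>m\<close>
      makes the coefficient of \<open>y m\<close> nonzero, so \<open>y m\<close> is a combination of
      \<open>y 0\<close> to \<open>y l\<close> with \<open>l = m - 1\<close>, and the span of these
      is stable under \<open>Y 0\<close>.\<close>
    then obtain m where m: "w \<in> span (y ` Suc ` {..<m})" and least: "\<And>k. k < m \<Longrightarrow> w \<notin> span (y ` Suc ` {..<k})"
      using LeastI_ex[of "\<lambda>m. w \<in> span (y ` Suc ` {..<m})"] not_less_Least by metis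
    have "m \<noteq> 0" using m w(2) by (intro notI) simp
    then obtain l where l: "m = Suc l" using not0_implies_Suc by blast
    let ?F = "span (y ` {..<Suc l})"
    have *: "y ` Suc ` {..<l} \<subseteq> y ` {..<Suc l}" by auto
    have "y ` Suc ` {..<m} = insert (y m) (y ` Suc ` {..<l})" by (simp add: l lessThan_Suc)
    then obtain c where c: "w - scale c (y m) \<in> span (y ` Suc ` {..<l})"
      using m span_breakdown_eq by metis
    have "c \<noteq> 0" using c least[of l] l by (intro notI) simp
    have "w - scale c (y m) \<in> ?F" using c span_mono[OF *] by blast
    moreover have "w \<in> ?F" unfolding y0[symmetric] by (intro span_base) auto
    ultimately have "w - (w - scale c (y m)) \<in> ?F" by (rule span_diff[rotated])
    then have "scale c (y m) \<in> ?F" by simp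
    then have "scale (1 / c) (scale c (y m)) \<in> ?F" by (rule span_scale)
    then have ym: "y m \<in> ?F" using \<open>c \<noteq> 0\<close> by simp
    have "E \<nu> \<subseteq> ?F"
    proof (rule generated)
      show "?F \<noteq> {0}" using w(2) \<open>w \<in> ?F\<close> by blast
      show "Y 0 t \<in> ?F" if "t \<in> ?F" for t
      proof -
        have "y ` Suc ` {..<Suc l} \<subseteq> ?F"
        proof
          fix z assume "z \<in> y ` Suc ` {..<Suc l}"
          then obtain k where "k < Suc l" "z = y (Suc k)" by auto
          then show "z \<in> ?F" using ym l by (cases "k = l") (auto intro!: span_base)
        qed
        then have "span (y ` Suc ` {..<Suc l}) \<subseteq> ?F" by (intro span_minimal subspace_span)
        then show ?thesis using Y_span[OF that] by blast
      qed
    qed (simp_all only: span_T subspace_span)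
    then show ?thesis by (intro exI[of _ "y ` {..<Suc l}"] conjI) auto
  qed
  then show "\<not> infinite_dimensional (E \<nu>)" by (simp add: infinite_dimensional_def)
qed

section \<open>Common kernels of finitely many operator words\<close>

text \<open>The last letter acts first: \<open>[IL (- 1), IL 2]\<close> stands for
  \<open>L 2\<close> followed by \<open>L (- 1)\<close>.\<close>

lemma linear_word: "Vector_Spaces.linear scale scale (foldr X is)"
proof (induction "is")
  case Nil
  then show ?case using linear_id by (simp add: id_def)
next
  case (Cons i "is")
  have "foldr X (i # is) = X i \<circ> foldr X is" by auto
  then show ?case using Vector_Spaces.linear_compose[OF Cons lin] by (simp only:)
qed

lemma word_E: "v \<in> E \<nu> \<Longrightarrow> foldr X is v \<in> E (\<nu> + of_int (sum_list (map deg is)))"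
proof (induction "is")
  case (Cons i "is")
  from X_E[OF Cons.IH[OF Cons.prems], of i] show ?case by (simp add: add_ac)
qed simp

text \<open>Each word maps into a finite-dimensional weight space, so imposing one more vanishing
  condition keeps the solution space infinite-dimensional.\<close>

lemma common_kernel:
  assumes "infinite_dimensional (E \<nu>)"
    and "\<And>is. is \<in> set ws \<Longrightarrow> \<not> infinite_dimensional (E (\<nu> + of_int (sum_list (map deg is))))"
  obtains v where "v \<in> E \<nu>" "v \<noteq> 0" "\<forall>is\<in>set ws. foldr X is v = 0"
proof -
  have "subspace {v \<in> E \<nu>. \<forall>is\<in>set ws. foldr X is v = 0} \<and>
    infinite_dimensional {v \<in> E \<nu>. \<forall>is\<in>set ws. foldr X is v = 0}"
    using assms(2)
  proof (induction ws)
    case Nil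
    then show ?case using assms(1) E_subspace by simp
  next
    case (Cons a ws)
    let ?W = "{v \<in> E \<nu>. \<forall>is\<in>set ws. foldr X is v = 0}"
    interpret f: Vector_Spaces.linear scale scale "foldr X a" by (rule linear_word)
    have IH: "subspace ?W" "infinite_dimensional ?W" using Cons by auto
    have eq: "{v \<in> E \<nu>. \<forall>is\<in>set (a # ws). foldr X is v = 0} = {v \<in> ?W. foldr X a v = 0}"
      by auto
    have "subspace {v \<in> ?W. foldr X a v = 0}"
      using IH(1) by (intro subspaceI)
        (auto simp: f.add f.scale f.zero dest: subspace_0 subspace_add subspace_scale)
    moreover have "infinite_dimensional {v \<in> ?W. foldr X a v = 0}"
      by (rule infinite_dimensional_kernel[OF IH linear_word, where F="E (\<nu> + of_int (sum_list (map deg a)))"])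
        (use word_E Cons.prems in auto)
    ultimately show ?case unfolding eq by (rule conjI)
  qed
  then obtain v where "v \<in> {v \<in> E \<nu>. \<forall>is\<in>set ws. foldr X is v = 0}" "v \<noteq> 0"
    by (auto elim: infinite_dimensional_nonzero)
  then show ?thesis using that by blast
qed

section \<open>Generators of the positive and negative parts\<close>

text \<open>The bracket of \<open>L 1\<close> and \<open>L n\<close> is \<open>n - 1\<close> times
  \<open>L (n + 1)\<close>. The factor vanishes at \<open>n = 1\<close>, so \<open>L 2\<close> has
  to be given separately.\<close>

lemma L_pos_zero:
  assumes "L 1 w = 0" "L 2 w = 0" "n \<ge> 1"
  shows "L n w = 0"
proof (cases "n = 1")
  case False
  then have "n \<ge> 2" using assms(3) by simp
  then show ?thesis
  proof (induction n rule: int_ge_induct)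
    case (step n)
    have "scale (of_int n - 1) (L (1 + n) w) = 0"
      using LL[of 1 n w] step.IH assms(1) by simp
    then show ?case using step.hyps by (simp add: add.commute)
  qed (rule assms(2))
qed (use assms in simp)

lemma of_int_neq_half: "complex_of_int n \<noteq> 1 / 2"
proof
  assume "complex_of_int n = 1 / 2"
  then have "complex_of_int (2 * n) = complex_of_int 1" by (simp add: mult.commute)
  then have "2 * n = 1" using of_int_eq_iff by blast
  then show False by presburger
qed

text \<open>Here the factor \<open>n - 1 / 2\<close> never vanishes, so \<open>Y 1\<close> alone
  starts the induction.\<close>

lemma Y_pos_zero:
  assumes "L 1 w = 0" "Y 1 w = 0" "n \<ge> 1"
  shows "Y n w = 0"
  using assms(3)
proof (induction n rule: int_ge_induct)
  case (step n)
  have "scale (of_int n - 1 / 2) (Y (1 + n) w) = 0"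
    using LY[of 1 n w] step.IH assms(1) by simp
  then show ?case using of_int_neq_half[of n] by (simp add: add.commute)
qed (rule assms(2))

lemma M_pos_zero:
  assumes "L 1 w = 0" "M 1 w = 0" "n \<ge> 1"
  shows "M n w = 0"
  using assms(3)
proof (induction n rule: int_ge_induct)
  case (step n)
  have "scale (of_int n) (M (1 + n) w) = 0"
    using LM[of 1 n w] step.IH assms(1) by simp
  then show ?case using step.hyps by (simp add: add.commute)
qed (rule assms(2))

lemma Y_M_neg_zero:
  assumes "L (- 1) w = 0" "Y (- 1) w = 0" "M (- 1) w = 0" "n \<le> - 1"
  shows "Y n w = 0" "M n w = 0"
proof -
  interpret r: irreducible_sv_rep scale "\<lambda>i v. - X (reflect i) v" by (rule reflected)
  show "Y n w = 0" "M n w = 0"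
    using r.Y_pos_zero[of w "- n"] r.M_pos_zero[of w "- n"] assms by simp_all
qed

text \<open>The disjunction lists the two ways to contradict \<open>highest_weight_vector\<close>:
  the weight space itself is too large, or some higher weight space is nonzero.\<close>

lemma no_highest_weight:
  assumes "w \<in> E \<nu>" "infinite_dimensional (E \<nu>) \<or> (n > 0 \<and> E (\<nu> + of_int n) \<noteq> {0})"
    and "L 1 w = 0" "L 2 w = 0" "Y 1 w = 0" "M 1 w = 0"
  shows "w = 0"
proof (rule ccontr)
  assume "w \<noteq> 0"
  moreover have "X i w = 0" if "deg i > 0" for i
    using that assms(3-6) L_pos_zero[of w "deg i"] Y_pos_zero[of w "deg i"] M_pos_zero[of w "deg i"]
    by (cases i) auto
  ultimately show False using highest_weight_vector(1)[of w \<nu>] highest_weight_vector(2)[of w \<nu> n] assms(1,2) by blast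
qed

lemma no_lowest_weight:
  assumes "w \<in> E \<nu>" "infinite_dimensional (E \<nu>) \<or> (n > 0 \<and> E (\<nu> - of_int n) \<noteq> {0})"
    and "L (- 1) w = 0" "L (- 2) w = 0" "Y (- 1) w = 0" "M (- 1) w = 0"
  shows "w = 0"
proof -
  interpret r: irreducible_sv_rep scale "\<lambda>i v. - X (reflect i) v" by (rule reflected)
  show ?thesis using assms by (intro r.no_highest_weight[of w "- \<nu>" n]) (auto simp: E_reflected)
qed

section \<open>A finite-dimensional weight space next to an infinite-dimensional one\<close>

text \<open>If both spaces above \<nu> were finite-dimensional, then \<open>L 1\<close>,
  \<open>L 2\<close>, \<open>Y 1\<close> and \<open>M 1\<close> would have a common nonzero kernel
  vector in \<open>E \<nu>\<close>, a highest weight vector in an infinite-dimensional weight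
  space.\<close>

lemma infinite_dimensional_beyond:
  assumes "infinite_dimensional (E \<nu>)" "\<not> infinite_dimensional (E (\<nu> + 1))"
  shows "infinite_dimensional (E (\<nu> + 2))"
proof (rule ccontr)
  assume *: "\<not> infinite_dimensional (E (\<nu> + 2))"
  obtain v where v: "v \<in> E \<nu>" "v \<noteq> 0"
    "\<forall>is\<in>set [[IL 1], [IL 2], [IY 1], [IM 1]]. foldr X is v = 0"
    by (rule common_kernel[OF assms(1), where ws="[[IL 1], [IL 2], [IY 1], [IM 1]]"]) (use assms(2) * in auto)
  then show False using no_highest_weight[of v \<nu> 0] assms(1) by simp
qed

text \<open>The \<open>Y n\<close> and \<open>M n\<close> span an ideal, so the vectors killed by
  all of them form a submodule.\<close>

lemma Y_M_zero:
  assumes "w \<noteq> 0" "\<And>n. Y n w = 0" "\<And>n. M n w = 0"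
  shows "Y n v = 0" "M n v = 0"
proof -
  let ?W = "{v. \<forall>n. Y n v = 0 \<and> M n v = 0}"
  have "?W = {0} \<or> ?W = UNIV"
  proof (rule irred)
    show "subspace ?W" by (rule subspaceI) (auto simp: X_simps)
    fix i v assume v: "v \<in> ?W"
    have "Y n (X i v) = 0 \<and> M n (X i v) = 0" for n
      using v LY[of "deg i" n v] LM[of "deg i" n v] YY[of n "deg i" v] YM[of "deg i" n v]
        YM[of n "deg i" v] MM[of n "deg i" v]
      by (cases i) auto
    then show "X i v \<in> ?W" by blast
  qed
  then show "Y n v = 0" "M n v = 0" using assms by blast+
qed

lemma finite_between_infinite_Y_M_zero:
  assumes "infinite_dimensional (E (\<mu> - 1))" "\<not> infinite_dimensional (E \<mu>)"
  shows "Y n x = 0" "M n x = 0"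
proof -
  \<comment> \<open>Every word in the list has total degree 1 and so maps into the
    finite-dimensional \<open>E \<mu>\<close>.\<close>
  obtain v where v: "v \<in> E (\<mu> - 1)" "v \<noteq> 0"
    "\<forall>is\<in>set [[IL 1], [IY 1], [IM 1], [IL (- 1), IL 2], [IY (- 1), IL 2], [IM (- 1), IL 2]]. foldr X is v = 0"
    by (rule common_kernel[OF assms(1), where ws="[[IL 1], [IY 1], [IM 1], [IL (- 1), IL 2], [IY (- 1), IL 2], [IM (- 1), IL 2]]"]) (use assms(2) in auto)
  define u where "u = L 2 v"
  have v': "L 1 v = 0" "Y 1 v = 0" "M 1 v = 0" using v(3) by simp_all
  have u: "L (- 1) u = 0" "Y (- 1) u = 0" "M (- 1) u = 0" unfolding u_def using v(3) by simp_all
  \<comment> \<open>Otherwise \<open>L 2\<close> would kill \<open>v\<close> as well, making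
    \<open>v\<close> a highest weight vector in an infinite-dimensional weight space.\<close>
  have "u \<noteq> 0" using no_highest_weight[of v "\<mu> - 1" 0] v v' assms(1) unfolding u_def by auto
  have pos: "Y n u = 0" "M n u = 0" if "n \<ge> 1" for n
    unfolding u_def using that LY[of 2 n v] LM[of 2 n v] v' Y_pos_zero[of v] M_pos_zero[of v] by simp_all
  \<comment> \<open>Degree 0 is reached from both sides: \<open>Y 0\<close> is a multiple of the
    bracket of \<open>L (- 1)\<close> and \<open>Y 1\<close>, and \<open>M 0\<close> of the bracket
    of \<open>Y 1\<close> and \<open>Y (- 1)\<close>.\<close>
  have "Y 0 u = 0" using LY[of "- 1" 1 u] pos[of 1] u by simp
  moreover have "M 0 u = 0" using YY[of 1 "- 1" u] pos[of 1] u by simp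
  ultimately have "Y n u = 0 \<and> M n u = 0" for n
    using pos[of n] Y_M_neg_zero[OF u, of n] by (cases "n \<ge> 1"; cases "n = 0") auto
  then show "Y n x = 0" "M n x = 0" using Y_M_zero[OF \<open>u \<noteq> 0\<close>] by blast+
qed

section \<open>The degree-five relation and the weights it permits\<close>

lemma L0_E: "v \<in> E \<nu> \<Longrightarrow> L 0 v = scale \<nu> v" by (simp add: E_def)

text \<open>Two multiples of \<open>L\<^sub>5\<close> expressed through \<open>L\<^sub>1\<close> and \<open>L\<^sub>2\<close>, \<open>[L\<^sub>1, [L\<^sub>1, L\<^sub>3]]\<close> and \<open>[L\<^sub>2, L\<^sub>3]\<close>, give the
  first relation among the generators of the positive part.\<close>

lemma serre_relation:
  assumes "L 1 v = 0"
  shows "L 1 (L 1 (L 1 (L 2 v))) - scale 6 (L 2 (L 1 (L 2 v))) + scale 6 (L 3 (L 2 v)) = 0"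
proof -
  have 1: "L 1 (L 2 v) = L 3 v" using LL[of 1 2 v] assms by simp
  have 2: "L 1 (L 3 v) = scale 2 (L 4 v)" using LL[of 1 3 v] assms by simp
  have 3: "L 1 (L 4 v) = scale 3 (L 5 v)" using LL[of 1 4 v] assms by simp
  have 4: "L 2 (L 3 v) = L 3 (L 2 v) + L 5 v" using LL[of 2 3 v] by simp
  show ?thesis by (simp add: 1 2 3 4 X_simps scale_right_distrib)
qed

text \<open>Since \<open>L (- 1)\<close> kills \<open>u\<close>, each application of it lowers the
  relation by one degree and contributes a linear factor in \<open>h\<close>. The scalars 6, 4 and 2
  that split off are nonzero.\<close>

lemma serre_consequences:
  assumes u: "u \<in> E h" "L (- 1) u = 0"
    and D: "L 1 (L 1 (L 1 u)) - scale 6 (L 2 (L 1 u)) + scale 6 (L 3 u) = 0"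
  shows "scale (h - 2) (L 1 (L 1 u) - scale 2 (L 2 u)) = 0"
    and "scale ((h - 2) * (h - 1)) (L 1 u) = 0"
    and "scale ((h - 2) * (h - 1) * h) u = 0"
proof -
  have E: "L 1 u \<in> E (h + 1)" "L 1 (L 1 u) \<in> E (h + 2)"
    using X_E[OF u(1), of "IL 1"] X_E[OF X_E[OF u(1), of "IL 1"], of "IL 1"] by (simp_all add: add.assoc)
  have 1: "L (- 1) (L 1 u) = scale (2 * h) u"
    using LL[of "- 1" 1 u] u L0_E[OF u(1)] by simp
  have 2: "L (- 1) (L 1 (L 1 u)) = scale (4 * h + 2) (L 1 u)"
    using LL[of "- 1" 1 "L 1 u"] L0_E[OF E(1)] by (simp add: 1 X_simps flip: scale_left_distrib)
  have 3: "L (- 1) (L 1 (L 1 (L 1 u))) = scale (6 * h + 6) (L 1 (L 1 u))"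
    using LL[of "- 1" 1 "L 1 (L 1 u)"] L0_E[OF E(2)] by (simp add: 2 X_simps flip: scale_left_distrib)
  have 4: "L (- 1) (L 2 u) = scale 3 (L 1 u)"
    using LL[of "- 1" 2 u] u by simp
  have 5: "L (- 1) (L 2 (L 1 u)) = scale (2 * h) (L 2 u) + scale 3 (L 1 (L 1 u))"
    using LL[of "- 1" 2 "L 1 u"] by (simp add: 1 X_simps)
  have 6: "L (- 1) (L 3 u) = scale 4 (L 2 u)"
    using LL[of "- 1" 3 u] u by simp
  have "0 = L (- 1) (L 1 (L 1 (L 1 u)) - scale 6 (L 2 (L 1 u)) + scale 6 (L 3 u))"
    unfolding D by simp
  also have "\<dots> = scale 6 (scale (h - 2) (L 1 (L 1 u) - scale 2 (L 2 u)))"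
    by (simp add: X_simps 3 5 6 scale_right_distrib scale_right_diff_distrib scale_left_distrib
        scale_left_diff_distrib) (simp add: algebra_simps flip: scale_left_distrib)
  finally show A: "scale (h - 2) (L 1 (L 1 u) - scale 2 (L 2 u)) = 0" by simp
  have "0 = L (- 1) (scale (h - 2) (L 1 (L 1 u) - scale 2 (L 2 u)))" unfolding A by simp
  also have "\<dots> = scale 4 (scale ((h - 2) * (h - 1)) (L 1 u))"
    by (simp add: X_simps 2 4 flip: scale_left_diff_distrib)
  finally show B: "scale ((h - 2) * (h - 1)) (L 1 u) = 0" by (simp only: scale_eq_0_iff) simp
  have "0 = L (- 1) (scale ((h - 2) * (h - 1)) (L 1 u))" unfolding B by simp
  also have "\<dots> = scale 2 (scale ((h - 2) * (h - 1) * h) u)"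
    by (simp only: X_simps 1 scale_scale) (simp add: mult_ac)
  finally show "scale ((h - 2) * (h - 1) * h) u = 0" by (simp only: scale_eq_0_iff) simp
qed

text \<open>With \<open>h = \<mu> + 1\<close> the last consequence leaves \<open>h\<close> in {0, 1,
  2}, and \<open>h = 0\<close> is excluded because \<open>u\<close> would be a highest weight
  vector. The equation for \<open>L 1 (L (- 2) u)\<close> prepares the descending half of the
  submodule built from \<open>u\<close>.\<close>

lemma obtain_special_vector:
  assumes inf: "infinite_dimensional (E (\<mu> - 1))" "\<not> infinite_dimensional (E \<mu>)"
      "infinite_dimensional (E (\<mu> + 1))"
    and YM: "\<And>n x. Y n x = 0" "\<And>n x. M n x = 0"
  obtains u where "u \<noteq> 0" "u \<in> E (\<mu> + 1)" "L (- 1) u = 0" "L 1 (L (- 2) u) = 0"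
    "L 1 (L 1 (L 1 u)) - scale 6 (L 2 (L 1 u)) + scale 6 (L 3 u) = 0" "\<mu> = 0 \<or> \<mu> = 1"
proof -
  \<comment> \<open>Again all words have total degree 1.\<close>
  obtain v where v: "v \<in> E (\<mu> - 1)" "v \<noteq> 0"
    "\<forall>is\<in>set [[IL 1], [IL (- 1), IL 2], [IL 1, IL (- 2), IL 2]]. foldr X is v = 0"
    by (rule common_kernel[OF inf(1), where ws="[[IL 1], [IL (- 1), IL 2], [IL 1, IL (- 2), IL 2]]"]) (use inf(2) in auto)
  define u where "u = L 2 v"
  have v': "L 1 v = 0" using v(3) by simp
  have u: "L (- 1) u = 0" "L 1 (L (- 2) u) = 0" unfolding u_def using v(3) by simp_all
  have "u \<noteq> 0" using no_highest_weight[of v "\<mu> - 1" 0] v v' inf(1) YM unfolding u_def by auto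
  have uE: "u \<in> E (\<mu> + 1)" unfolding u_def by (rule X_E'[OF v(1)]) simp
  note D = serre_relation[OF v', folded u_def]
  note C = serre_consequences[OF uE u(1) D]
  have "\<mu> \<noteq> - 1"
  proof
    assume \<mu>: "\<mu> = - 1"
    have "L 1 u = 0" "L 2 u = 0" using C(1,2) unfolding \<mu> by simp_all
    then show False using no_highest_weight[of u "\<mu> + 1" 0] uE inf(3) YM \<open>u \<noteq> 0\<close> by auto
  qed
  then have "\<mu> = 0 \<or> \<mu> = 1" using C(3) \<open>u \<noteq> 0\<close> by (auto simp: add_eq_0_iff2)
  then show ?thesis using that \<open>u \<noteq> 0\<close> uE u D by blast
qed

section \<open>The submodule of intermediate series type at \<mu> = 0\<close>

text \<open>Writing \<open>e k\<close> for \<open>a (k - 1)\<close> divided by the factorial of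
  \<open>k - 1\<close>, the formulas below say \<open>L m (e k) = k * e (k + m)\<close> with
  \<open>e 0 = 0\<close> and \<open>e (- 1) = z\<close>. This is an intermediate series module with
  its trivial submodule at weight 0 factored out; only \<open>L (- 2) (a 0) = z\<close> leaves the
  ascending half.\<close>

lemma raising_half:
  assumes u: "u \<in> E 1" "L (- 1) u = 0" "L 1 (L 1 u) = scale 2 (L 2 u)"
    and z: "z = L (- 2) u" "L 1 z = 0" "L 2 z = - u" "E 1 \<noteq> {0}"
    and YM: "\<And>n x. Y n x = 0" "\<And>n x. M n x = 0"
  defines "a \<equiv> \<lambda>n. (L 1 ^^ n) u"
  shows "a n \<in> E (of_nat n + 1)"
    and "k \<in> {1, 2, - 1, - 2} \<Longrightarrow> L k (a n) \<in> span (range a \<union> {z})"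
proof -
  have a0: "a 0 = u" and aSuc: "L 1 (a n) = a (Suc n)" for n by (simp_all add: a_def)
  show aE: "a n \<in> E (of_nat n + 1)" for n
  proof (induction n)
    case (Suc n)
    then show ?case unfolding aSuc[symmetric] by (rule X_E') simp
  qed (simp add: a0 u)
  note L0 = L0_E[OF aE]
  have m1: "L (- 1) (a (Suc n)) = scale ((of_nat n + 1) * (of_nat n + 2)) (a n)" for n
  proof (induction n)
    case 0
    show ?case using LL[of "- 1" 1 u] u L0_E[OF u(1)] by (simp add: aSuc[symmetric] a0)
  next
    case (Suc n)
    have "L (- 1) (L 1 (a (Suc n))) = scale ((of_nat n + 1) * (of_nat n + 2)) (a (Suc n))
        + scale 2 (scale (of_nat (Suc n) + 1) (a (Suc n)))"
      using LL[of "- 1" 1 "a (Suc n)"] by (simp add: Suc X_simps aSuc L0)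
    also have "\<dots> = scale ((of_nat (Suc n) + 1) * (of_nat (Suc n) + 2)) (a (Suc n))"
      by (simp add: algebra_simps flip: scale_left_distrib)
    finally show ?case by (simp add: aSuc)
  qed
  have m1_0: "L (- 1) (a 0) = 0" using u a0 by simp
  have m2_1: "L (- 2) (a (Suc 0)) = 0"
    using LL[of "- 2" 1 u] u z by (simp add: aSuc[symmetric] a0)
  have m2: "L (- 2) (a (Suc (Suc n))) = scale ((of_nat n + 1) * (of_nat n + 2) * (of_nat n + 3)) (a n)" for n
  proof (induction n)
    case 0
    show ?case using LL[of "- 2" 1 "a (Suc 0)"] m2_1 m1[of 0] by (simp add: aSuc)
  next
    case (Suc n)
    have "L (- 2) (L 1 (a (Suc (Suc n)))) = scale ((of_nat n + 1) * (of_nat n + 2) * (of_nat n + 3)) (a (Suc n))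
        + scale 3 (scale ((of_nat (Suc n) + 1) * (of_nat (Suc n) + 2)) (a (Suc n)))"
      using LL[of "- 2" 1 "a (Suc (Suc n))"] by (simp add: Suc X_simps aSuc m1)
    also have "\<dots> = scale ((of_nat (Suc n) + 1) * (of_nat (Suc n) + 2) * (of_nat (Suc n) + 3)) (a (Suc n))"
      by (simp add: algebra_simps flip: scale_left_distrib)
    finally show ?case by (simp add: aSuc)
  qed
  have p2: "L 2 (a n) = scale (1 / (of_nat n + 2)) (a (Suc (Suc n)))" for n
  \<comment> \<open>Strong induction is used because \<open>L (- 1) d\<close> involves the formula
    at \<open>n - 1\<close> and \<open>L (- 2) d\<close> the one at \<open>n - 2\<close>.\<close>
  proof (induction n rule: less_induct)
    case (less n)
    define d where "d = L 2 (a n) - scale (1 / (of_nat n + 2)) (a (Suc (Suc n)))"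
    txt \<open>\<open>L\<^sub>-\<^sub>1\<close> and \<open>L\<^sub>-\<^sub>2\<close> kill \<open>d\<close> by the induction hypothesis, and a lowest weight vector above
      weight \<open>1\<close> cannot exist.\<close>
    have "d = 0"
    proof (rule no_lowest_weight[where n = "int n + 2"])
      have "L 2 (a n) \<in> E (of_nat n + 3)" by (rule X_E'[OF aE]) simp
      moreover have "a (Suc (Suc n)) \<in> E (of_nat n + 3)" using aE[of "Suc (Suc n)"] by (simp add: add_ac)
      ultimately show "d \<in> E (of_nat n + 3)"
        unfolding d_def using subspace_diff subspace_scale E_subspace by blast
      \<comment> \<open>Descending \<open>n + 2\<close> steps from weight \<open>n + 3\<close>
        reaches weight 1, which occurs by hypothesis.\<close>
      show "infinite_dimensional (E (of_nat n + 3)) \<or>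
          int n + 2 > 0 \<and> E (of_nat n + 3 - of_int (int n + 2)) \<noteq> {0}"
        using z(4) by simp
      have "of_nat (k + 1) \<noteq> (0::complex)" "of_nat (k + numeral q) \<noteq> (0::complex)" for k q
        by (simp_all only: of_nat_eq_0_iff) simp_all
      then have c: "of_nat k + 1 \<noteq> (0::complex)" "of_nat k + numeral q \<noteq> (0::complex)" for k q
        by (simp_all only: of_nat_add of_nat_1 of_nat_numeral not_False_eq_True)
      show "L (- 1) d = 0"
      proof (cases n)
        case 0
        then show ?thesis using u by (simp add: d_def a0 aSuc[symmetric])
      next
        case (Suc k)
        have "L 2 (a k) = scale (1 / (of_nat k + 2)) (a (Suc (Suc k)))" using less Suc by simp
        then have "L (- 1) (L 2 (a n)) = scale ((of_nat k + 1) + 3) (a (Suc (Suc k)))"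
          using LL[of "- 1" 2 "a n"] c[of k]
          by (simp add: Suc m1 X_simps aSuc flip: scale_left_distrib)
        then show ?thesis using c[of k] c[of "Suc k"] by (simp add: d_def X_simps m1 Suc add_ac)
      qed
      show "L (- 2) d = 0"
      proof (cases n)
        case 0
        then show ?thesis using u by (simp add: d_def a0 aSuc[symmetric])
      next
        case (Suc k)
        show ?thesis
        proof (cases k)
          case 0
          have "L (- 2) (L 2 (a n)) = scale 8 (a n)"
            using LL[of "- 2" 2 "a n"] L0[of n] by (simp add: m2_1 Suc 0)
          then show ?thesis by (simp add: d_def X_simps m2 Suc 0)
        next
          case (Suc j)
          have n: "n = Suc (Suc j)" using \<open>n = Suc k\<close> Suc by simp
          have "L 2 (a j) = scale (1 / (of_nat j + 2)) (a n)" using less n by simp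
          then have "L (- 2) (L 2 (a n)) = scale ((of_nat j + 1) * (of_nat j + 3) + 4 * (of_nat j + 3)) (a n)"
            using LL[of "- 2" 2 "a n"] L0[of n] c[of j]
            by (simp add: n m2 X_simps add_ac flip: scale_left_distrib)
          then show ?thesis using c[of j]
            by (simp add: d_def X_simps m2 n add_ac flip: scale_left_diff_distrib) (simp add: algebra_simps)
        qed
      qed
    qed (simp_all add: YM)
    then show ?case by (simp add: d_def)
  qed
  let ?W = "span (range a \<union> {z})"
  have aW: "a n \<in> ?W" "z \<in> ?W" for n by (auto intro: span_base)
  show "L k (a n) \<in> ?W" if "k \<in> {1, 2, - 1, - 2}"
  proof -
    have "L 1 (a n) \<in> ?W" "L 2 (a n) \<in> ?W" using aW by (auto simp: aSuc p2 intro: span_scale)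
    moreover have "L (- 1) (a n) \<in> ?W" using aW by (cases n) (auto simp: m1 m1_0 intro: span_scale span_zero)
    moreover have "L (- 2) (a n) \<in> ?W"
    proof (cases n)
      case 0
      then show ?thesis using aW a0 z(1) by simp
    next
      case (Suc k)
      then show ?thesis using aW by (cases k) (auto simp: m2 m2_1 intro: span_scale span_zero)
    qed
    ultimately show ?thesis using that by auto
  qed
qed

text \<open>As for vanishing, \<open>L (n + 1)\<close> is recovered from the bracket of
  \<open>L 1\<close> and \<open>L n\<close> on dividing by \<open>n - 1\<close>. The vector stays
  arbitrary in the induction because the bracket also applies \<open>L n\<close> to
  \<open>L 1 w\<close>.\<close>

lemma L_pos_closed:
  assumes W: "subspace W" "\<And>w. w \<in> W \<Longrightarrow> L 1 w \<in> W" "\<And>w. w \<in> W \<Longrightarrow> L 2 w \<in> W"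
    and "w \<in> W" "n \<ge> 1"
  shows "L n w \<in> W"
proof (cases "n = 1")
  case False
  then have "n \<ge> 2" using assms(5) by simp
  then show ?thesis using \<open>w \<in> W\<close>
  proof (induction n arbitrary: w rule: int_ge_induct)
    case (step n)
    have "L 1 (L n w) - L n (L 1 w) \<in> W"
      using step W by (intro subspace_diff[OF W(1)]) auto
    then have "scale (of_int n - 1) (L (1 + n) w) \<in> W" using LL[of 1 n w] by simp
    then have "scale (1 / (of_int n - 1)) (scale (of_int n - 1) (L (1 + n) w)) \<in> W"
      by (rule subspace_scale[OF W(1)])
    then show ?case using step.hyps by (simp add: add.commute)
  qed (rule W(3))
qed (use assms in simp)

lemma L_closed:
  assumes W: "subspace W" "\<And>k w. k \<in> {1, 2, - 1, - 2} \<Longrightarrow> w \<in> W \<Longrightarrow> L k w \<in> W"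
    and w: "w \<in> W"
  shows "L n w \<in> W"
proof -
  interpret r: irreducible_sv_rep scale "\<lambda>i v. - X (reflect i) v" by (rule reflected)
  have "L n w \<in> W" if "n \<ge> 1"
    by (rule L_pos_closed[OF W(1) _ _ w that]) (simp_all add: W(2))
  moreover have "L n w \<in> W" if "n \<le> - 1"
  proof -
    have "- X (reflect (IL (- n))) w \<in> W"
      by (rule r.L_pos_closed[OF W(1) _ _ w]) (use that in \<open>simp_all add: W(2) subspace_neg[OF W(1)]\<close>)
    then show ?thesis using subspace_neg[OF W(1)] by fastforce
  qed
  moreover have "L n w \<in> W" if "n = 0"
  proof -
    have "L (- 1) (L 1 w) - L 1 (L (- 1) w) \<in> W"
      by (intro subspace_diff[OF W(1)] W(2) w) simp_all
    then have "scale 2 (L 0 w) \<in> W" using LL[of "- 1" 1 w] by simp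
    then have "scale (1 / 2) (scale 2 (L 0 w)) \<in> W" by (rule subspace_scale[OF W(1)])
    then show ?thesis using that by simp
  qed
  ultimately show ?thesis by linarith
qed

text \<open>The ascending half starts at \<open>u\<close> and, by reflection, the descending half
  starts at \<open>z = L (- 2) u\<close>. Together they span a submodule whose only generator of
  weight 1 is \<open>u\<close>, while \<open>E 1\<close> is infinite-dimensional.\<close>

lemma no_finite_between_infinite_at_0:
  assumes inf: "infinite_dimensional (E (- 1))" "\<not> infinite_dimensional (E 0)" "infinite_dimensional (E 1)"
    and YM: "\<And>n x. Y n x = 0" "\<And>n x. M n x = 0"
  shows False
proof -
  interpret r: irreducible_sv_rep scale "\<lambda>i v. - X (reflect i) v" by (rule reflected)
  obtain u where u: "u \<noteq> 0" "u \<in> E (0 + 1)" "L (- 1) u = 0" "L 1 (L (- 2) u) = 0"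
    "L 1 (L 1 (L 1 u)) - scale 6 (L 2 (L 1 u)) + scale 6 (L 3 u) = 0"
    by (rule obtain_special_vector[of 0]) (use inf YM in auto)
  define z where "z = L (- 2) u"
  have z1: "L 1 z = 0" using u(4) by (simp add: z_def)
  have uE: "u \<in> E 1" using u(2) by simp
  have zE: "z \<in> E (- 1)" unfolding z_def by (rule X_E'[OF uE]) simp
  have u2: "L 1 (L 1 u) = scale 2 (L 2 u)"
    using serre_consequences(1)[OF uE u(3,5)] by simp
  \<comment> \<open>In the reflected representation \<open>- z\<close> is the image of
    \<open>u\<close> under \<open>L 2\<close>, and \<open>u\<close> is killed by \<open>L 1\<close>
    there. So the degree-five relation and its consequences hold for \<open>- z\<close> with
    \<open>h = 1\<close>.\<close>
  have z2: "L (- 1) (L (- 1) z) = - scale 2 (L (- 2) z)"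
  proof -
    have "- z \<in> r.E 1" using zE subspace_neg[OF E_subspace] by (simp add: E_reflected)
    then show ?thesis
      using r.serre_consequences(1)[of "- z" 1] r.serre_relation[of u] u(3) z1
      by (simp add: z_def X_simps add_eq_0_iff2)
  qed
  \<comment> \<open>Applying \<open>L (- 2)\<close> to both sides of \<open>u2\<close> determines
    \<open>L 2 z\<close>: the left side gives \<open>6 u\<close>, the right side
    \<open>2 (L 2 z + 4 u)\<close>.\<close>
  have "L (- 2) (L 1 (L 1 u)) = scale 6 u"
  proof -
    have "L (- 1) (L 1 u) = scale 2 u" using LL[of "- 1" 1 u] u(3) L0_E[OF uE] by simp
    moreover have "L (- 2) (L 1 u) = 0" using LL[of "- 2" 1 u] u(3,4) by simp
    ultimately show ?thesis using LL[of "- 2" 1 "L 1 u"] by simp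
  qed
  moreover have "L (- 2) (L 2 u) = L 2 z + scale 4 u"
    using LL[of "- 2" 2 u] L0_E[OF uE] by (simp add: z_def)
  ultimately have "scale 6 u = scale 2 (L 2 z + scale 4 u)" using u2 by (simp add: X_simps)
  moreover have "scale 2 (L 2 z + u) = scale 2 (L 2 z + scale 4 u) - scale 6 u"
    by (simp add: scale_right_distrib add_diff_eq[symmetric] flip: scale_left_diff_distrib)
  ultimately have "scale 2 (L 2 z + u) = 0" by simp
  then have z3: "L 2 z = - u" by (simp add: add_eq_0_iff2)
  have E1: "E 1 \<noteq> {0}" "E (- 1) \<noteq> {0}" using inf(1,3) infinite_dimensional_nonzero by blast+

  define a where "a n = (L 1 ^^ n) u" for n
  define b where "b n = ((\<lambda>v. - X (reflect (IL 1)) v) ^^ n) z" for n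
  note ha = raising_half[OF uE u(3) u2 z_def z1 z3 E1(1) YM, folded a_def]
  \<comment> \<open>These are the hypotheses of \<open>raising_half\<close> in the reflected
    representation, with \<open>u\<close> and \<open>z\<close> exchanged.\<close>
  have rz: "z \<in> r.E 1" "- X (reflect (IL (- 1))) z = 0"
    "- X (reflect (IL 1)) (- X (reflect (IL 1)) z) = scale 2 (- X (reflect (IL 2)) z)"
    "u = - X (reflect (IL (- 2))) z" "- X (reflect (IL 1)) u = 0" "- X (reflect (IL 2)) u = - z"
    "r.E 1 \<noteq> {0}"
    using zE z1 z2 z3 u(3) E1(2) by (simp_all add: E_reflected X_simps z_def)
  have rYM: "- X (reflect (IY n)) x = 0" "- X (reflect (IM n)) x = 0" for n x
    by (simp_all add: YM)
  note hb = r.raising_half[OF rz rYM, folded b_def]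
  let ?W = "span (range a \<union> range b)"
  have a0: "a 0 = u" and b0: "b 0 = z" by (simp_all add: a_def b_def)
  have sub: "span (range a \<union> {z}) \<subseteq> ?W" "span (range b \<union> {u}) \<subseteq> ?W"
    by (rule span_mono; use a0 b0 in \<open>auto intro: range_eqI[of _ _ 0]\<close>)+
  have "?W = {0} \<or> ?W = UNIV"
  proof (rule irred[OF subspace_span])
    have generators: "L k w \<in> ?W" if k: "k \<in> {1, 2, - 1, - 2}" and w: "w \<in> ?W" for k w
      using w
    proof (induction rule: span_induct_alt)
      case (step c y x)
      have "L k y \<in> ?W"
      proof (cases "y \<in> range a")
        case True
        then show ?thesis using ha(2)[OF k] sub(1) by blast
      next
        case False
        then obtain n where "y = b n" using step by blast
        have "- k \<in> {1, 2, - 1, - 2}" using k by auto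
        from hb(2)[OF this, of n] have "- L k (b n) \<in> span (range b \<union> {u})" by simp
        then have "- L k (b n) \<in> ?W" using sub(2) by blast
        then have "- (- L k (b n)) \<in> ?W" by (rule span_neg)
        then show ?thesis using \<open>y = b n\<close> by simp
      qed
      then show ?case using step by (auto simp: X_simps intro: span_add span_scale)
    qed (simp add: span_zero)
    have "L n w \<in> ?W" if "w \<in> ?W" for n w
      by (rule L_closed[OF subspace_span generators that])
    then show "X i w \<in> ?W" if "w \<in> ?W" for i w
      using that YM span_zero by (cases i) auto
  qed
  moreover have "u \<in> ?W" using a0 by (auto intro!: span_base intro: range_eqI[of _ _ 0])
  ultimately have W: "?W = UNIV" using u(1) by blast
  \<comment> \<open>All generators of \<open>?W\<close> except \<open>u = a 0\<close> have weight
    different from 1.\<close>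
  let ?N = "- {1 :: complex}"
  have "range a \<union> range b \<subseteq> insert u (\<Union>\<kappa>\<in>?N. E \<kappa>)"
  proof -
    have "a n \<in> insert u (\<Union>\<kappa>\<in>?N. E \<kappa>)" for n
    proof (cases n)
      case (Suc k)
      have "of_nat (Suc k) \<noteq> (0::complex)" by (simp only: of_nat_eq_0_iff)
      then have "of_nat n + 1 \<noteq> (1::complex)" using Suc by simp
      then show ?thesis using ha(1)[of n] by blast
    qed (use a0 in simp)
    moreover have "b n \<in> (\<Union>\<kappa>\<in>?N. E \<kappa>)" for n
    proof -
      have "b n \<in> E (- of_nat n - 1)" using hb(1)[of n] by (simp add: E_reflected)
      moreover have "- of_nat n - 1 \<noteq> (1::complex)"
      proof
        assume "- of_nat n - 1 = (1::complex)"
        moreover have "of_nat (n + 2) = 1 - (- of_nat n - 1 :: complex)" by simp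
        ultimately have "of_nat (n + 2) = (0::complex)" by simp
        then show False by (simp only: of_nat_eq_0_iff)
      qed
      ultimately show ?thesis by blast
    qed
    ultimately show ?thesis by blast
  qed
  then have W': "x \<in> span (insert u (\<Union>\<kappa>\<in>?N. E \<kappa>))" for x
    using W span_mono by blast
  have "E 1 \<subseteq> span {u}"
  proof
    fix x assume x: "x \<in> E 1"
    obtain k where k: "x - scale k u \<in> span (\<Union>\<kappa>\<in>?N. E \<kappa>)"
      using W'[of x] span_breakdown_eq by blast
    have "x - scale k u \<in> E 1"
      using x uE by (intro subspace_diff subspace_scale E_subspace)
    then have "x - scale k u = 0" by (rule E_independent[OF _ k]) simp
    then show "x \<in> span {u}" by (simp add: span_scale span_base)
  qed
  then show False using inf(3) unfolding infinite_dimensional_def by blast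
qed

section \<open>Propagation of infinite dimension and the support\<close>

lemma infinite_dimensional_right:
  assumes "infinite_dimensional (E \<nu>)"
  shows "infinite_dimensional (E (\<nu> + 1))"
proof (rule ccontr)
  assume fin: "\<not> infinite_dimensional (E (\<nu> + 1))"
  define \<mu> where "\<mu> = \<nu> + 1"
  have inf: "infinite_dimensional (E (\<mu> - 1))" "\<not> infinite_dimensional (E \<mu>)"
      "infinite_dimensional (E (\<mu> + 1))"
    using assms fin infinite_dimensional_beyond[OF assms fin] by (simp_all add: \<mu>_def add.assoc)
  note YM = finite_between_infinite_Y_M_zero[OF inf(1,2)]
  interpret r: irreducible_sv_rep scale "\<lambda>i v. - X (reflect i) v" by (rule reflected)
  have "\<mu> = 0 \<or> \<mu> = 1" by (rule obtain_special_vector[OF inf YM])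
  \<comment> \<open>The configuration around \<mu> is symmetric, so the restriction on \<mu> also
    holds for \<open>- \<mu>\<close>; the two together leave only 0.\<close>
  moreover have "- \<mu> = 0 \<or> - \<mu> = 1"
  proof (rule r.obtain_special_vector)
    show "infinite_dimensional (r.E (- \<mu> - 1))" "\<not> infinite_dimensional (r.E (- \<mu>))"
      "infinite_dimensional (r.E (- \<mu> + 1))"
      using inf by (simp_all add: E_reflected add.commute)
    show "- X (reflect (IY n)) x = 0" "- X (reflect (IM n)) x = 0" for n x
      by (simp_all add: YM)
  qed
  ultimately have "\<mu> = 0" by auto
  then show False using no_finite_between_infinite_at_0[OF _ _ _ YM] inf by simp
qed

lemma infinite_dimensional_left:
  assumes "infinite_dimensional (E \<nu>)"
  shows "infinite_dimensional (E (\<nu> - 1))"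
proof -
  interpret r: irreducible_sv_rep scale "\<lambda>i v. - X (reflect i) v" by (rule reflected)
  show ?thesis using r.infinite_dimensional_right[of "- \<nu>"] assms by (simp add: E_reflected)
qed

lemma infinite_dimensional_all:
  assumes "infinite_dimensional (E \<nu>)"
  shows "infinite_dimensional (E (\<nu> + of_int k))"
proof (induction k rule: int_induct[of _ 0])
  case base
  then show ?case using assms by simp
next
  case (step1 i)
  then show ?case using infinite_dimensional_right[of "\<nu> + of_int i"] by (simp add: add.assoc)
next
  case (step2 i)
  then show ?case using infinite_dimensional_left[of "\<nu> + of_int i"] by (simp add: algebra_simps)
qed

text \<open>The weight spaces on the lattice through \<nu> already span the module, so independence
  leaves no room for any other weight.\<close>

lemma support_eq:
  assumes "infinite_dimensional (E \<nu>)"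
  shows "{\<mu>. E \<mu> \<noteq> {0}} = {\<nu> + of_int k | k. True}"
proof (intro equalityI subsetI)
  fix \<mu> assume "\<mu> \<in> {\<nu> + of_int k | k. True}"
  then obtain k where "\<mu> = \<nu> + of_int k" by blast
  then show "\<mu> \<in> {\<mu>. E \<mu> \<noteq> {0}}"
    using infinite_dimensional_nonzero[OF infinite_dimensional_all[OF assms, of k]] by blast
next
  fix \<mu> assume "\<mu> \<in> {\<mu>. E \<mu> \<noteq> {0}}"
  then obtain x where x: "x \<in> E \<mu>" "x \<noteq> 0" using subspace_0[OF E_subspace] by blast
  obtain w where w: "w \<in> E \<nu>" "w \<noteq> 0" using infinite_dimensional_nonzero[OF assms] .
  have "x \<in> span (\<Union>\<kappa>\<in>{\<nu> + of_int k | k. True}. E \<kappa>)" using span_E_lattice[OF w] by blast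
  then show "\<mu> \<in> {\<nu> + of_int k | k. True}" using E_independent[OF x(1)] x(2) by blast
qed

end

section \<open>From the Lie module to the operator representation\<close>

definition basis_vector :: "sv_index \<Rightarrow> sv" where
  "basis_vector i = Poly_Mapping.single i 1"

lemma basis_vector_simps [simp]:
  "basis_vector (IL n) = sv_L n" "basis_vector (IY n) = sv_Y n" "basis_vector (IM n) = sv_M n"
  by (simp_all add: basis_vector_def sv_L_def sv_Y_def sv_M_def)

lemma (in sv_module) irreducible_sv_repI:
  assumes irred: irreducible_module and weight: weight_module
  shows "irreducible_sv_rep scale (\<lambda>i. act (basis_vector i))"
proof -
  have add_left: "act (x + y) v = act x v + act y v"
    and scale_left: "act (sv_scale c x) v = scale c (act x v)"
    and zero_left: "act 0 v = 0" for x y c v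
  proof -
    interpret f: Vector_Spaces.linear sv_scale scale "\<lambda>x. act x v" by (rule act_linear_left)
    show "act (x + y) v = act x v + act y v" "act (sv_scale c x) v = scale c (act x v)" "act 0 v = 0"
      by (simp_all add: f.add f.scale f.zero)
  qed
  have add_right: "act x (v + w) = act x v + act x w"
    and scale_right: "act x (scale c v) = scale c (act x v)" 
    and zero_right: "act x 0 = 0" for x c v w
  proof -
    interpret f: Vector_Spaces.linear scale scale "act x" by (rule act_linear_right)
    show "act x (v + w) = act x v + act x w" "act x (scale c v) = scale c (act x v)" "act x 0 = 0"
      by (simp_all add: f.add f.scale f.zero)
  qed
  have comm: "act x (act y v) = act y (act x v) + act (sv_bracket x y) v" for x y v
    by (simp add: act_bracket)
  have sub: "submodule W" if W: "V.subspace W" "\<And>i w. w \<in> W \<Longrightarrow> act (basis_vector i) w \<in> W" for W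
  proof -
    have "act x w \<in> W" if w: "w \<in> W" for x w
    proof (induction x rule: sv_induct)
      case (L n)
      then show ?case using W(2)[OF w, of "IL n"] by simp
    next
      case (Y n)
      then show ?case using W(2)[OF w, of "IY n"] by simp
    next
      case (M n)
      then show ?case using W(2)[OF w, of "IM n"] by simp
    qed (auto simp: add_left scale_left zero_left
          intro: V.subspace_add[OF W(1)] V.subspace_scale[OF W(1)] V.subspace_0[OF W(1)])
    then show ?thesis using W(1) by (simp add: submodule_def)
  qed
  have irred': "W = {0} \<or> W = UNIV" if "V.subspace W" "\<And>i w. w \<in> W \<Longrightarrow> act (basis_vector i) w \<in> W" for W
    using irred sub[OF that] by (simp add: irreducible_module_def)
  have central: "sv_bracket (basis_vector i) (sv_M 0) = 0" for i
    by (cases i) (simp_all add: sv_relations)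
  \<comment> \<open>A member of the diagonalizing basis is an eigenvector of \<open>sv_M 0\<close>.
    Its eigenspace is a submodule because \<open>sv_M 0\<close> is central, hence it is the whole
    module.\<close>
  have "\<exists>c. \<forall>v. act (sv_M 0) v = scale c v"
  proof -
    obtain B where B: "V.independent B" "V.span B = UNIV" "\<forall>h\<in>sv_cartan. \<forall>b\<in>B. \<exists>c. act h b = scale c b"
      using weight by (auto simp: weight_module_def acts_diagonalizably_def)
    have "B \<noteq> {}" using B(2) irred by (auto simp: irreducible_module_def)
    then obtain b where b: "b \<in> B" by blast
    then have "b \<noteq> 0" using B(1) V.dependent_zero by blast
    have "sv_M 0 \<in> sv_cartan" by (simp add: sv_cartan_def sv.span_base)
    then obtain c where c: "act (sv_M 0) b = scale c b" using B(3) b by blast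
    let ?W = "{v. act (sv_M 0) v = scale c v}"
    have "?W = {0} \<or> ?W = UNIV"
    proof (rule irred')
      show "V.subspace ?W"
        by (rule V.subspaceI) (simp_all add: zero_right add_right scale_right V.scale_right_distrib V.scale_left_commute)
      show "act (basis_vector i) w \<in> ?W" if "w \<in> ?W" for i w
        using that comm[of "basis_vector i" "sv_M 0" w] by (simp add: central zero_left scale_right)
    qed
    then show ?thesis using \<open>b \<noteq> 0\<close> c by blast
  qed
  then have M0: "\<exists>c. \<forall>v. act (basis_vector (IM 0)) v = scale c v" by simp
  show ?thesis
  proof
    fix n p m m' v
    show "act (basis_vector (IL n)) (act (basis_vector (IL p)) v) =
        act (basis_vector (IL p)) (act (basis_vector (IL n)) v) +
        scale (of_int p - of_int n) (act (basis_vector (IL (n + p))) v)"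
      using comm[of "sv_L n" "sv_L p" v] by (simp add: sv_relations scale_left)
    show "act (basis_vector (IL n)) (act (basis_vector (IY m)) v) =
        act (basis_vector (IY m)) (act (basis_vector (IL n)) v) +
        scale (of_int m - of_int n / 2) (act (basis_vector (IY (n + m))) v)"
      using comm[of "sv_L n" "sv_Y m" v] by (simp add: sv_relations scale_left)
    show "act (basis_vector (IL n)) (act (basis_vector (IM p)) v) =
        act (basis_vector (IM p)) (act (basis_vector (IL n)) v) +
        scale (of_int p) (act (basis_vector (IM (n + p))) v)"
      using comm[of "sv_L n" "sv_M p" v] by (simp add: sv_relations scale_left)
    show "act (basis_vector (IY m)) (act (basis_vector (IY m')) v) =
        act (basis_vector (IY m')) (act (basis_vector (IY m)) v) +
        scale (of_int m' - of_int m) (act (basis_vector (IM (m + m'))) v)"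
      using comm[of "sv_Y m" "sv_Y m'" v] by (simp add: sv_relations scale_left)
    show "act (basis_vector (IY m)) (act (basis_vector (IM p)) v) =
        act (basis_vector (IM p)) (act (basis_vector (IY m)) v)"
      using comm[of "sv_Y m" "sv_M p" v] by (simp add: sv_relations zero_left)
    show "act (basis_vector (IM n)) (act (basis_vector (IM p)) v) =
        act (basis_vector (IM p)) (act (basis_vector (IM n)) v)"
      using comm[of "sv_M n" "sv_M p" v] by (simp add: sv_relations zero_left)
  qed (fact add_right scale_right irred' M0)+
qed

theorem theorem1p3:
  fixes scale :: "complex \<Rightarrow> 'v::ab_group_add \<Rightarrow> 'v"
    and act :: "sv \<Rightarrow> 'v \<Rightarrow> 'v"
    and lam :: complex
  assumes "sv_module scale act"
    and "lie_module.irreducible_module scale act"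
    and "sv_module.weight_module scale act"
    and "vector_space.infinite_dimensional scale (sv_module.weight_space scale act lam)"
  shows "sv_module.support scale act = {lam + of_int k | k. True} \<and>
    (\<forall>k::int. vector_space.infinite_dimensional scale
       (sv_module.weight_space scale act (lam + of_int k)))"
proof -
  interpret sv_module scale act by fact
  interpret rep: irreducible_sv_rep scale "\<lambda>i. act (basis_vector i)"
    using assms(2,3) by (rule irreducible_sv_repI)
  have E: "weight_space \<mu> = rep.E \<mu>" for \<mu>
    by (simp add: weight_space_def rep.E_def)
  have "V.infinite_dimensional (rep.E lam)" using assms(4) by (simp add: E)
  then show ?thesis
    using rep.infinite_dimensional_all rep.support_eq by (simp add: E support_def)
qed

end
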